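(* For every nonnegative integer $n$, the number of signed partitions $\sigma=(\pi,\nu)$ of $n+1$ such that (i) $\pi_1$, the largest positive part, is odd, (ii) the integers $1,2,\dots,\frac{\pi_1-1}{2}$ all appear as positive parts an even number of times and at least twice, (iii) the integers $\frac{\pi_1-1}{2}+1,\frac{\pi_1-1}{2}+2,\dots,\pi_1$ all appear as positive parts at least once, and (iv) there are exactly $\frac{\pi_1-1}{2}$ negative parts (counted with multiplicity), each $\equiv 1\pmod 3$ and $\leq \frac{3\pi_1-1}{2}$, with the negative parts greater than $1$ occurring at most once, equals the number of (ordinary) partitions of $n$ into parts congruent to $1,2,4,5,7$ or $8$ modulo $9$ such that for any nonnegative integer $j$, $9j+1$ and $9j+2$ do not both appear as parts, and for any nonnegative integer $k$, $9k+7$ and $9k+8$ do not both appear as parts.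
   Context: A partition $\lambda$ of length $\ell=\ell(\lambda)$ is an $\ell$-tuple $(\lambda_1,\dots,\lambda_\ell)$ of positive integers (its parts) with $\lambda_i\geq\lambda_{i+1}$ for $1\le i\le \ell-1$; its weight is $|\lambda|=\sum_i\lambda_i$, and it is a partition of $n$ if $|\lambda|=n$. The empty partition (length $0$, weight $0$) is allowed. A signed partition $\sigma$ of an integer $n$ is a pair $(\pi,\nu)$ of partitions with $n=|\pi|-|\nu|$; the parts of $\pi$ are called the positive parts of $\sigma$ and the parts of $\nu$ (which are positive integers) are called the negative parts of $\sigma$. In the claim $\pi$ is nonempty (it has a largest part $\pi_1$), while $\nu$ may be empty; a list of integers such as $1,2,\dots,\frac{\pi_1-1}{2}$ is empty when its upper end is $0$. *)

theory Defs
  imports Main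
begin

definition is_partition :: "nat list \<Rightarrow> bool" where
  "is_partition p \<longleftrightarrow> sorted_wrt (\<ge>) p \<and> (\<forall>x\<in>set p. x > 0)"

definition partition_of :: "nat \<Rightarrow> nat list \<Rightarrow> bool" where
  "partition_of n p \<longleftrightarrow> is_partition p \<and> sum_list p = n"

text \<open>The negative parts are stored as positive integers, as the parts of the second component.\<close>

definition signed_partition_of :: "int \<Rightarrow> nat list \<times> nat list \<Rightarrow> bool" where
  "signed_partition_of n \<sigma> \<longleftrightarrow> is_partition (fst \<sigma>) \<and> is_partition (snd \<sigma>) \<and>
     n = int (sum_list (fst \<sigma>)) - int (sum_list (snd \<sigma>))"

text \<open>The largest part \<open>\<pi>\<^sub>1\<close> of a nonempty partition is its first entry; it is only used
  below for nonempty \<open>\<pi>\<close>, where it is odd, so that the halves taken with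
  \<^term>\<open>(div)\<close> are exact and the natural-number subtractions do not truncate.\<close>

abbreviation largest_part :: "nat list \<Rightarrow> nat" where
  "largest_part p \<equiv> hd p"

end

theory Submission
  imports Defs "HOL-Library.Multiset" "HOL-Library.Nat_Bijection" "HOL-Library.Disjoint_Sets"
    "HOL-Computational_Algebra.Formal_Power_Series"
begin

text \<open>
Fix the largest positive part \<open>2k + 1\<close> of a signed partition as in the theorem. The negative parts
larger than 1 are distinct members of \<open>{4, 7, ..., 3k+1}\<close>, and the number of parts 1 is forced because
there are \<open>k\<close> negative parts altogether. So they are encoded by the set \<open>D\<close> of those \<open>i\<close> in \<open>{1..k}\<close> for
which \<open>3i + 1\<close> is missing, and then the sum of the negative parts is \<open>k + 3(1 + ... + k) - 3 \<Sum>D\<close>.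
Hence the negative contribution turns into a constant minus a weight that joins the positive parts:
up to the constant shift, the signed partitions with largest part \<open>2k + 1\<close> have generating
function
  \<open>q^(k(k+1)) (1+q^3)...(1+q^(3k)) / ((1+q)...(1+q^k) (q;q)_(2k+1))
     = q^(k(k+1)) A_k(q) / (q;q)_(2k+1)\<close>,  where  \<open>A_k(q) = \<Prod>i=1..k. (1 - q^i + q^(2i))\<close>.

The sum over \<open>k\<close> is evaluated for \<open>A_k(q) = \<Prod>i=1..k. (1 - t q^i + q^(2i))\<close> with any \<open>t\<close>, by Bailey's
method. A finite form of Jacobi's triple product (\<open>finite_triple_product\<close>) expands
\<open>A_k(q) = \<Sum>r. c_r q^(r(r+1)/2) [2k+1; k-r]\<close> with coefficients \<open>c_r\<close> that depend on \<open>t\<close> only. Inserting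
this and summing over \<open>k\<close> by Durfee rectangles (\<open>durfee_sum\<close>, \<open>bailey_transform\<close>) gives
\<open>(q;q)_\<infinity> * sum = \<Sum>r. c_r q^(3r(r+1)/2)\<close>. The right-hand side is what the same expansion of \<open>A_k\<close> gives
for \<open>k = \<infinity>\<close> with \<open>q^3\<close> in place of \<open>q\<close>, namely \<open>(q^3;q^3)_\<infinity> A_\<infinity>(q^3)\<close>. So the same
theta series arises twice, and it cancels whatever the values \<open>c_r\<close> are (\<open>slater_sum_mod\<close>).

For \<open>t = 1\<close> we have \<open>A_\<infinity>(Q) = \<Prod>i. (1+Q^(3i))/(1+Q^i)\<close>, and by Euler's identity this is the product of
\<open>1 - Q^m\<close> over the odd \<open>m\<close> not divisible by 3 (\<open>qquad_1_mod\<close>). With \<open>Q = q^3\<close>, the factor \<open>1 - q^(3m)\<close>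
with \<open>m = 2b + 1\<close> belongs to the pair of parts \<open>3b+1, 3b+2\<close>: since \<open>3m = (3b+1) + (3b+2)\<close>, it is
precisely the factor that forbids the two to occur together. The condition that 3 does not divide
\<open>m\<close> says that \<open>b\<close> is not 1 modulo 3, so the forbidden pairs are \<open>9j+1, 9j+2\<close> and \<open>9j+7, 9j+8\<close>, and what
remains, \<open>(q^3;q^3)_\<infinity>/(q;q)_\<infinity>\<close>, generates the partitions into parts not divisible by 3.

Infinite products are never formed. All identities with \<open>\<infinity>\<close> are stated as congruences modulo
\<open>q^(N+1)\<close> between finite sums and products, which suffices to compare the coefficients up to \<open>N\<close>.
\<close>

section \<open>Gaussian binomials and the finite triple product\<close>

definition qpoch :: "'a::comm_ring_1 \<Rightarrow> nat \<Rightarrow> 'a" where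
  "qpoch q n = (\<Prod>i=1..n. 1 - q ^ i)"

lemma qpoch_0 [simp]: "qpoch q 0 = 1"
  and qpoch_Suc: "qpoch q (Suc n) = qpoch q n * (1 - q ^ Suc n)"
  by (simp_all add: qpoch_def)

text \<open>
The Gaussian binomial coefficient. Defined by Pascal's rule rather than by a quotient, it makes sense
in every commutative ring. It vanishes for \<open>k > n\<close>, so that sums may run past their natural range.
\<close>
fun qbinom :: "'a::comm_ring_1 \<Rightarrow> nat \<Rightarrow> nat \<Rightarrow> 'a" where
  "qbinom q n 0 = 1"
| "qbinom q 0 (Suc k) = 0"
| "qbinom q (Suc n) (Suc k) = qbinom q n k + q ^ Suc k * qbinom q n (Suc k)"

lemma qbinom_eq_0: "n < k \<Longrightarrow> qbinom q n k = 0"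
  by (induction q n k rule: qbinom.induct) auto

lemma qbinom_self [simp]: "qbinom q n n = 1"
  by (induction n) (simp_all add: qbinom_eq_0)

text \<open>
The second of the two \<open>q\<close>-analogues of Pascal's rule: the power of \<open>q\<close> sits on the other summand.
\<close>
lemma qbinom_Suc_Suc':
  "k \<le> n \<Longrightarrow> qbinom q (Suc n) (Suc k) = q ^ (n - k) * qbinom q n k + qbinom q n (Suc k)"
proof (induction n arbitrary: k)
  case 0
  then show ?case by simp
next
  case (Suc n)
  show ?case
  proof (cases k)
    case 0
    then show ?thesis using Suc.IH[of 0] by (simp add: algebra_simps)
  next
    case (Suc j)
    show ?thesis
    proof (cases "k \<le> n")
      case True
      then obtain d where n: "n = k + d" using le_Suc_ex by blast
      have 1: "qbinom q (Suc n) (Suc j) = q ^ (n - j) * qbinom q n j + qbinom q n (Suc j)"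
        using Suc.IH[of j] True Suc by simp
      have 2: "qbinom q (Suc n) (Suc k) = q ^ (n - k) * qbinom q n k + qbinom q n (Suc k)"
        using Suc.IH[of k] True by simp
      have "qbinom q (Suc (Suc n)) (Suc k)
          = qbinom q (Suc n) (Suc j) + q ^ Suc k * qbinom q (Suc n) (Suc k)"
        by (simp add: Suc)
      also have "\<dots> = q ^ (n - j) * qbinom q n j + qbinom q n k
          + q ^ Suc k * (q ^ (n - k) * qbinom q n k + qbinom q n (Suc k))"
        using 1 2 Suc by simp
      also have "\<dots> = q ^ (Suc n - k) * (qbinom q n j + q ^ Suc j * qbinom q n k)
          + (qbinom q n k + q ^ Suc k * qbinom q n (Suc k))"
        using Suc by (simp add: n algebra_simps power_add)
      finally show ?thesis by (simp add: Suc)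
    next
      case False
      with \<open>k \<le> Suc n\<close> have "k = Suc n" by simp
      then show ?thesis by (simp add: qbinom_eq_0 del: qbinom.simps(3)) 
    qed
  qed
qed

text \<open>
Complementation exchanges the two forms of Pascal's rule.
\<close>
lemma qbinom_symmetric: "qbinom q (k + d) k = qbinom q (k + d) d"
proof (induction "k + d" arbitrary: k d)
  case 0
  then show ?case by simp
next
  case (Suc n)
  show ?case
  proof (cases "k = 0 \<or> d = 0")
    case False
    then obtain k' d' where kd: "k = Suc k'" "d = Suc d'" by (metis not0_implies_Suc)
    have n: "n = k' + d" "n = k + d'" using Suc.hyps(2) kd by auto
    have "qbinom q (Suc n) (Suc k') = q ^ (n - k') * qbinom q n k' + qbinom q n k"
      using n kd by (subst qbinom_Suc_Suc') auto
    also have "\<dots> = q ^ Suc d' * qbinom q n d + qbinom q n d'"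
      using Suc.hyps(1)[OF n(1)] Suc.hyps(1)[OF n(2)] n kd by simp
    also have "\<dots> = qbinom q (Suc n) (Suc d')" by (simp add: kd)
    finally show ?thesis using Suc.hyps(2) kd by simp
  qed auto
qed

lemma qbinom_mult_qpoch: "qbinom q (k + d) k * (qpoch q k * qpoch q d) = qpoch q (k + d)"
proof (induction "k + d" arbitrary: k d)
  case 0
  then show ?case by simp
next
  case (Suc n)
  show ?case
  proof (cases "k = 0 \<or> d = 0")
    case False
    then obtain k' d' where kd: "k = Suc k'" "d = Suc d'" by (metis not0_implies_Suc)
    have n: "n = k' + d" "n = k + d'" using Suc.hyps(2) kd by auto
    have "qbinom q (Suc n) (Suc k') * (qpoch q k * qpoch q d)
        = (qbinom q n k' * (qpoch q k' * qpoch q d)) * (1 - q ^ k)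
        + q ^ k * ((qbinom q n k * (qpoch q k * qpoch q d')) * (1 - q ^ d))"
      by (simp add: kd qpoch_Suc algebra_simps)
    also have "\<dots> = qpoch q n * (1 - q ^ k) + q ^ k * (qpoch q n * (1 - q ^ d))"
      using Suc.hyps(1)[OF n(1)] Suc.hyps(1)[OF n(2)] n by simp
    also have "\<dots> = qpoch q n * (1 - q ^ (k + d))" by (simp add: algebra_simps power_add)
    also have "\<dots> = qpoch q (Suc n)" unfolding Suc.hyps(2)[symmetric] by (rule qpoch_Suc[symmetric])
    finally show ?thesis using Suc.hyps(2) kd by simp
  qed auto
qed

text \<open>
If \<open>t = z + 1/z\<close>, then \<open>signed_dirichlet t r\<close> is \<open>(-1)^r\<close> times \<open>\<Sum>j=-r..r. z^j\<close>. These are the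
coefficients of the triple product after the factor \<open>1 - 1/z\<close> has been divided out; the recursion
avoids \<open>z\<close> itself, which for \<open>t = 1\<close> would be a primitive sixth root of unity.
\<close>
fun signed_dirichlet :: "'a::comm_ring_1 \<Rightarrow> nat \<Rightarrow> 'a" where
  "signed_dirichlet t 0 = 1"
| "signed_dirichlet t (Suc 0) = - (t + 1)"
| "signed_dirichlet t (Suc (Suc r)) = - t * signed_dirichlet t (Suc r) - signed_dirichlet t r"

text \<open>
For \<open>t = z + 1/z\<close> the factors are \<open>(1 - z q^i) (1 - q^i / z)\<close>.
\<close>
definition qquad :: "'a::comm_ring_1 \<Rightarrow> 'a \<Rightarrow> nat \<Rightarrow> 'a" where
  "qquad t q n = (\<Prod>i=1..n. 1 - t * q ^ i + q ^ (2 * i))"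

text \<open>
The Gaussian binomial \<open>[2n+1; n-r]\<close> is written in its complementary form \<open>[2n+1; n+1+r]\<close>, which
vanishes for \<open>r > n\<close>, whereas \<open>n - r\<close> would be cut off at 0.
\<close>
definition jtp_coeff :: "'a::comm_ring_1 \<Rightarrow> nat \<Rightarrow> nat \<Rightarrow> 'a" where
  "jtp_coeff q n r = q ^ triangle r * qbinom q (2 * n + 1) (n + 1 + r)"

text \<open>
Multiplication by \<open>1 - t q^(n+1) + q^(2n+2)\<close> acts on the coefficients of the kernels
\<open>\<Sum>j=-r..r. z^j\<close> in this way, because multiplying a kernel by \<open>t = z + 1/z\<close> yields the sum of its two
neighbours, with \<open>r - 1\<close> and \<open>r + 1\<close> in place of \<open>r\<close>. The identities themselves are two applications of Pascal's rule. At \<open>r = 0\<close> the missing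
neighbour at \<open>r = -1\<close> is, by symmetry, the one at \<open>r = 0\<close>.
\<close>
lemma jtp_coeff_rec:
  fixes q :: "'a::comm_ring_1" and n :: nat
  defines "D \<equiv> jtp_coeff q"
  shows "D (Suc n) (Suc r) = (1 + q ^ (2 * n + 2)) * D n (Suc r) + q ^ (n + 1) * (D n r + D n (Suc (Suc r)))"
    and "D (Suc n) 0 = (1 + q ^ (2 * n + 2)) * D n 0 + q ^ (n + 1) * (D n 0 + D n (Suc 0))"
proof -
  \<comment> \<open>The lower index is raised twice: first by the defining Pascal rule, then by the second one.\<close>
  have pascal2: "qbinom q (Suc (Suc (2 * n + 1))) (Suc (Suc j))
      = q ^ (2 * n + 1 - j) * qbinom q (2 * n + 1) j + (1 + q ^ (2 * n + 2)) * qbinom q (2 * n + 1) (Suc j)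
        + q ^ Suc (Suc j) * qbinom q (2 * n + 1) (Suc (Suc j))" if j: "j \<le> 2 * n + 1" for j
  proof (cases "j = 2 * n + 1")
    case True
    then show ?thesis by (simp add: qbinom_eq_0 del: qbinom.simps(3)) 
  next
    case False
    have "qbinom q (Suc (Suc (2 * n + 1))) (Suc (Suc j))
        = qbinom q (Suc (2 * n + 1)) (Suc j) + q ^ Suc (Suc j) * qbinom q (Suc (2 * n + 1)) (Suc (Suc j))"
      by simp
    also have "qbinom q (Suc (2 * n + 1)) (Suc j) =
        q ^ (2 * n + 1 - j) * qbinom q (2 * n + 1) j + qbinom q (2 * n + 1) (Suc j)"
      using j by (rule qbinom_Suc_Suc')
    also have "qbinom q (Suc (2 * n + 1)) (Suc (Suc j)) =
        q ^ (2 * n + 1 - Suc j) * qbinom q (2 * n + 1) (Suc j) + qbinom q (2 * n + 1) (Suc (Suc j))"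
      using j False by (intro qbinom_Suc_Suc') simp
    also have "q ^ Suc (Suc j) * (q ^ (2 * n + 1 - Suc j) * qbinom q (2 * n + 1) (Suc j) + qbinom q (2 * n + 1) (Suc (Suc j)))
        = q ^ (Suc (Suc j) + (2 * n + 1 - Suc j)) * qbinom q (2 * n + 1) (Suc j)
          + q ^ Suc (Suc j) * qbinom q (2 * n + 1) (Suc (Suc j))"
      by (simp only: power_add algebra_simps)
    also have "Suc (Suc j) + (2 * n + 1 - Suc j) = 2 * n + 2" using j False by simp
    finally show ?thesis by (simp add: algebra_simps)
  qed
  show "D (Suc n) (Suc r) = (1 + q ^ (2 * n + 2)) * D n (Suc r) + q ^ (n + 1) * (D n r + D n (Suc (Suc r)))"
  proof (cases "r \<le> n")
    case True
    define d where "d = n - r"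
    have n: "n = r + d" using True by (simp add: d_def)
    have "D (Suc n) (Suc r) = q ^ triangle (Suc r) *
        qbinom q (Suc (Suc (2 * n + 1))) (Suc (Suc (n + 1 + r)))"
      by (simp add: D_def jtp_coeff_def del: qbinom.simps triangle_Suc)
    also have "\<dots> = q ^ triangle (Suc r) * (q ^ (n - r) * qbinom q (2 * n + 1) (n + 1 + r)
       + (1 + q ^ (2 * n + 2)) * qbinom q (2 * n + 1) (n + 1 + Suc r)
        + q ^ (n + r + 3) * qbinom q (2 * n + 1) (n + 1 + Suc (Suc r)))"
      using True by (subst pascal2) (simp_all add: numeral_3_eq_3)
    also have "\<dots> = (1 + q ^ (2 * n + 2)) * D n (Suc r)
        + (q ^ (triangle (Suc r) + (n - r)) * qbinom q (2 * n + 1) (n + 1 + r)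
        + q ^ (triangle (Suc r) + (n + r + 3)) * qbinom q (2 * n + 1) (n + 1 + Suc (Suc r)))"
      unfolding D_def jtp_coeff_def by (simp only: power_add algebra_simps)
    also have "triangle (Suc r) + (n - r) = (n + 1) + triangle r" using True by simp
    also have "triangle (Suc r) + (n + r + 3) = (n + 1) + triangle (Suc (Suc r))" by simp
    finally show ?thesis unfolding D_def jtp_coeff_def by (simp only: power_add algebra_simps)
  next
    case False
    then show ?thesis by (simp add: D_def jtp_coeff_def qbinom_eq_0 del: qbinom.simps)
  qed
  have sym: "qbinom q (2 * n + 1) n = qbinom q (2 * n + 1) (n + 1)"
    using qbinom_symmetric[of q n "n + 1"] by (simp add: mult_2 del: qbinom.simps)
  have "D (Suc n) 0 = qbinom q (Suc (Suc (2 * n + 1))) (Suc (Suc n))"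
    by (simp add: D_def jtp_coeff_def del: qbinom.simps)
  also have "\<dots> = q ^ (n + 1) * qbinom q (2 * n + 1) (n + 1)
       + (1 + q ^ (2 * n + 2)) * qbinom q (2 * n + 1) (n + 1)
        + q ^ (n + 2) * qbinom q (2 * n + 1) (n + 1 + Suc 0)"
    using pascal2[of n] sym by (simp add: Suc_diff_le del: qbinom.simps)
  finally show "D (Suc n) 0 = (1 + q ^ (2 * n + 2)) * D n 0 + q ^ (n + 1) * (D n 0 + D n (Suc 0))"
    unfolding D_def jtp_coeff_def by (simp add: algebra_simps del: qbinom.simps)
qed

text \<open>
A finite Jacobi triple product in which the exponents \<open>r\<close> and \<open>-r-1\<close> have been combined. The
induction compares coefficients: the factor of index \<open>n + 1\<close> is distributed over the sum with
\<open>jtp_coeff_rec\<close>, and the shifted sums are put together again with the recursion of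
\<open>signed_dirichlet\<close>.
\<close>
lemma finite_triple_product:
  "qquad t q n = (\<Sum>r\<le>n. signed_dirichlet t r * jtp_coeff q n r)"
proof (induction n)
  case 0
  then show ?case by (simp add: qquad_def jtp_coeff_def)
next
  case (Suc n)
  define D where "D = jtp_coeff q"
  note rec = jtp_coeff_rec[where q = q, folded D_def]
  have D0: "D n r = 0" if "r > n" for r using that by (simp add: D_def jtp_coeff_def qbinom_eq_0 del: qbinom.simps)
  define S where "S = (\<Sum>r\<le>n. signed_dirichlet t r * D n r)"
  have S': "S = D n 0 + (\<Sum>r\<le>n. signed_dirichlet t (Suc r) * D n (Suc r))"
    using sum.atMost_Suc_shift[of "\<lambda>r. signed_dirichlet t r * D n r" n] by (simp add: S_def D0)
  \<comment> \<open>The boundary terms that appear in \<open>up\<close> and \<open>down\<close> combine with those of \<open>rec(2)\<close>.\<close>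
  have up: "(\<Sum>r\<le>n. signed_dirichlet t r * D n (Suc r)) = D n (Suc 0) + (\<Sum>r\<le>n. signed_dirichlet t (Suc r) * D n (Suc (Suc r)))"
    using sum.atMost_Suc_shift[of "\<lambda>r. signed_dirichlet t r * D n (Suc r)" n] by (simp add: D0)
  have down: "(\<Sum>r\<le>n. signed_dirichlet t (Suc r) * D n r) = - (t + 1) * D n 0 + (\<Sum>r\<le>n. signed_dirichlet t (Suc (Suc r)) * D n (Suc r))"
    using sum.atMost_Suc_shift[of "\<lambda>r. signed_dirichlet t (Suc r) * D n r" n] by (simp add: D0)
  \<comment> \<open>The recursion of the coefficients, applied to \<open>c_(r+2) + c_r\<close>.\<close>
  have middle: "(\<Sum>r\<le>n. signed_dirichlet t (Suc (Suc r)) * D n (Suc r)) + (\<Sum>r\<le>n. signed_dirichlet t r * D n (Suc r))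
      = - t * (\<Sum>r\<le>n. signed_dirichlet t (Suc r) * D n (Suc r))"
    by (simp add: sum.distrib[symmetric] sum_distrib_left algebra_simps)
  have "(\<Sum>r\<le>Suc n. signed_dirichlet t r * D (Suc n) r)
      = D (Suc n) 0 + (\<Sum>r\<le>n. signed_dirichlet t (Suc r) * D (Suc n) (Suc r))"
    by (simp add: sum.atMost_Suc_shift del: sum.atMost_Suc)
  also have "(\<Sum>r\<le>n. signed_dirichlet t (Suc r) * D (Suc n) (Suc r)) =
      (1 + q ^ (2 * n + 2)) * (\<Sum>r\<le>n. signed_dirichlet t (Suc r) * D n (Suc r))
      + q ^ (n + 1) * ((\<Sum>r\<le>n. signed_dirichlet t (Suc r) * D n r) + (\<Sum>r\<le>n. signed_dirichlet t (Suc r) * D n (Suc (Suc r))))"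
    unfolding rec(1) by (simp add: sum.distrib sum_distrib_left algebra_simps)
  also have "D (Suc n) 0 + \<dots> = (1 + q ^ (2 * n + 2)) * S + q ^ (n + 1) *
      (D n 0 + ((\<Sum>r\<le>n. signed_dirichlet t (Suc r) * D n r) + (\<Sum>r\<le>n. signed_dirichlet t r * D n (Suc r))))"
    unfolding rec(2) S' up by (simp add: algebra_simps)
  also have "(\<Sum>r\<le>n. signed_dirichlet t (Suc r) * D n r) + (\<Sum>r\<le>n. signed_dirichlet t r * D n (Suc r))
      = - (t + 1) * D n 0 + - t * (\<Sum>r\<le>n. signed_dirichlet t (Suc r) * D n (Suc r))"
    unfolding down middle[symmetric] by simp
  also have "D n 0 + \<dots> = - t * S" unfolding S' by (simp add: algebra_simps)
  also have "(1 + q ^ (2 * n + 2)) * S + q ^ (n + 1) * (- t * S) = S * (1 - t * q ^ Suc n + q ^ (2 * Suc n))"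
    by (simp add: algebra_simps)
  also have "S = qquad t q n" by (simp add: S_def D_def Suc.IH)
  also have "qquad t q n * (1 - t * q ^ Suc n + q ^ (2 * Suc n)) = qquad t q (Suc n)"
    by (simp add: qquad_def)
  finally show ?case by (simp only: D_def)
qed

section \<open>The Bailey transform\<close>

text \<open>
The function \<open>u\<close> stands for \<open>1/(q;q)_n\<close>, so the statement makes sense in any commutative ring in which
these inverses exist. Combinatorially, a partition with parts at most \<open>M + s\<close> is dissected along its
largest rectangle with sides \<open>m\<close> and \<open>m + s\<close>. In the induction on \<open>M\<close> the second Pascal rule splits the
sum into those for \<open>(M, s)\<close> and \<open>(M, s + 1)\<close>.
\<close>
lemma durfee_sum:
  assumes u: "\<And>n. qpoch q n * u n = 1"
  shows "(\<Sum>m\<le>M. q ^ (m * (m + s)) * qbinom q M m * u (m + s)) = u (M + s)"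
proof (induction M arbitrary: s)
  case 0
  then show ?case by simp
next
  case (Suc M)
  have u_step: "u n = u (Suc n) * (1 - q ^ Suc n)" for n
  proof -
    have "u n = u n * (qpoch q (Suc n) * u (Suc n))" by (simp add: u)
    also have "\<dots> = (qpoch q n * u n) * (u (Suc n) * (1 - q ^ Suc n))"
      by (simp add: qpoch_Suc algebra_simps)
    finally show ?thesis by (simp add: u)
  qed
  let ?f = "\<lambda>M s m. q ^ (m * (m + s)) * qbinom q M m * u (m + s)"
  have step: "?f (Suc M) s (Suc m) = ?f M s (Suc m) + q ^ (M + s + 1) * ?f M (Suc s) m" if "m \<le> M" for m
  proof -
    have e: "Suc m * (Suc m + s) + (M - m) = (M + s + 1) + m * (m + Suc s)"
      using that by (simp add: algebra_simps)
    have "?f (Suc M) s (Suc m) = ?f M s (Suc m)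
        + q ^ (Suc m * (Suc m + s) + (M - m)) * qbinom q M m * u (m + Suc s)"
      unfolding qbinom_Suc_Suc'[OF that] power_add by (simp add: algebra_simps del: qbinom.simps)
    also have "q ^ (Suc m * (Suc m + s) + (M - m)) = q ^ (M + s + 1) * q ^ (m * (m + Suc s))"
      unfolding e power_add ..
    finally show ?thesis by (simp add: algebra_simps)
  qed
  have "(\<Sum>m\<le>Suc M. ?f (Suc M) s m) = u s + (\<Sum>m\<le>M. ?f (Suc M) s (Suc m))"
    by (subst sum.atMost_Suc_shift) simp
  also have "(\<Sum>m\<le>M. ?f (Suc M) s (Suc m))
      = (\<Sum>m\<le>M. ?f M s (Suc m) + q ^ (M + s + 1) * ?f M (Suc s) m)"
    by (intro sum.cong refl step) simp
  also have "\<dots> = (\<Sum>m\<le>M. ?f M s (Suc m)) + q ^ (M + s + 1) * u (M + Suc s)"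
    unfolding sum.distrib sum_distrib_left[symmetric] Suc.IH ..
  also have "u s + \<dots> = (\<Sum>m\<le>Suc M. ?f M s m) + q ^ (M + s + 1) * u (M + Suc s)"
    by (subst sum.atMost_Suc_shift) simp
  also have "(\<Sum>m\<le>Suc M. ?f M s m) = u (M + s)" by (simp add: Suc.IH qbinom_eq_0)
  also have "\<dots> + q ^ (M + s + 1) * u (M + Suc s) = u (Suc M + s)"
    using u_step[of "M + s"] by (simp add: algebra_simps)
  finally show ?case .
qed

lemma qbinom_conv_inverse:
  assumes u: "\<And>n. qpoch q n * u n = 1"
  shows "qbinom q (k + d) k = qpoch q (k + d) * u k * u d"
proof -
  have "qbinom q (k + d) k = qbinom q (k + d) k * (qpoch q k * u k) * (qpoch q d * u d)" by (simp add: u)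
  also have "\<dots> = (qbinom q (k + d) k * (qpoch q k * qpoch q d)) * u k * u d" by (simp add: algebra_simps)
  finally show ?thesis by (simp add: qbinom_mult_qpoch)
qed

lemma triangle_double: "2 * triangle r = r * (r + 1)"
  by (induction r) auto

text \<open>
The finite form of Bailey's lemma, for the pair given by \<open>finite_triple_product\<close>. After exchanging the
sums, the inner sum over \<open>n = r + m\<close> is \<open>durfee_sum\<close> with \<open>M = N - r\<close> and \<open>s = 2r + 1\<close>, because
\<open>n(n+1) = r(r+1) + m(m + 2r + 1)\<close>; together with \<open>r(r+1)/2\<close> the exponent \<open>r(r+1)\<close> gives \<open>3r(r+1)/2\<close>.
\<close>
lemma bailey_transform:
  assumes u: "\<And>n. qpoch q n * u n = 1"
  shows "(\<Sum>n\<le>N. q ^ (n * (n + 1)) * qquad t q n * u (2 * n + 1) * u (N - n))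
    = (\<Sum>r\<le>N. signed_dirichlet t r * q ^ (3 * triangle r) * u (N - r) * u (N + r + 1))"
proof -
  have "(\<Sum>n\<le>N. q ^ (n * (n + 1)) * qquad t q n * u (2 * n + 1) * u (N - n)) =
    (\<Sum>n\<le>N. \<Sum>r\<le>n. signed_dirichlet t r * q ^ (n * (n + 1) + triangle r) * (u (n + 1 + r) * u (n - r) * u (N - n)))"
  proof (intro sum.cong refl)
    fix n
    have "q ^ (n * (n + 1)) * qquad t q n * u (2 * n + 1) * u (N - n)
      = (\<Sum>r\<le>n. signed_dirichlet t r * q ^ (n * (n + 1) + triangle r) * (qbinom q (2 * n + 1) (n + 1 + r) * u (2 * n + 1) * u (N - n)))"
      unfolding finite_triple_product jtp_coeff_def sum_distrib_left sum_distrib_right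
      by (intro sum.cong refl) (simp add: power_add algebra_simps del: qbinom.simps)
    also have "\<dots> = (\<Sum>r\<le>n. signed_dirichlet t r * q ^ (n * (n + 1) + triangle r) * (u (n + 1 + r) * u (n - r) * u (N - n)))"
    proof (intro sum.cong refl)
      fix r assume "r \<in> {..n}"
      then have e: "n + 1 + r + (n - r) = 2 * n + 1" by simp
      have "qbinom q (2 * n + 1) (n + 1 + r) = qpoch q (2 * n + 1) * u (n + 1 + r) * u (n - r)"
        using qbinom_conv_inverse[OF u, of "n + 1 + r" "n - r"] unfolding e .
      then have "qbinom q (2 * n + 1) (n + 1 + r) * u (2 * n + 1)
          = (qpoch q (2 * n + 1) * u (2 * n + 1)) * (u (n + 1 + r) * u (n - r))"
        by (simp add: algebra_simps del: qbinom.simps)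
      then show "signed_dirichlet t r * q ^ (n * (n + 1) + triangle r) * (qbinom q (2 * n + 1) (n + 1 + r) * u (2 * n + 1) * u (N - n))
        = signed_dirichlet t r * q ^ (n * (n + 1) + triangle r) * (u (n + 1 + r) * u (n - r) * u (N - n))"
        unfolding u by (simp del: qbinom.simps)
    qed
    finally show "q ^ (n * (n + 1)) * qquad t q n * u (2 * n + 1) * u (N - n) =
      (\<Sum>r\<le>n. signed_dirichlet t r * q ^ (n * (n + 1) + triangle r) * (u (n + 1 + r) * u (n - r) * u (N - n)))" .
  qed
  also have "\<dots> = (\<Sum>r\<le>N. \<Sum>m\<le>N - r. signed_dirichlet t r * q ^ ((r + m) * (r + m + 1) + triangle r) *
      (u (r + m + 1 + r) * u m * u (N - (r + m))))"
    unfolding sum.Sigma[OF finite_atMost ballI[OF finite_atMost]]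
    by (rule sum.reindex_bij_witness[of _ "\<lambda>(r, m). (r + m, r)" "\<lambda>(n, r). (r, n - r)"]) auto
  also have "\<dots> = (\<Sum>r\<le>N. signed_dirichlet t r * q ^ (3 * triangle r) * u (N - r) * u (N + r + 1))"
  proof (intro sum.cong refl)
    fix r assume r: "r \<in> {..N}"
    define M where "M = N - r"
    have "(\<Sum>m\<le>M. signed_dirichlet t r * q ^ ((r + m) * (r + m + 1) + triangle r) *
      (u (r + m + 1 + r) * u m * u (N - (r + m))))
      = (\<Sum>m\<le>M. signed_dirichlet t r * q ^ (3 * triangle r) * u M * (q ^ (m * (m + (2 * r + 1))) * qbinom q M m * u (m + (2 * r + 1))))"
    proof (intro sum.cong refl)
      fix m assume m: "m \<in> {..M}"
      have e: "(r + m) * (r + m + 1) + triangle r = 3 * triangle r + m * (m + (2 * r + 1))"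
        using triangle_double[of r] by (simp add: algebra_simps)
      have e': "r + m + 1 + r = m + (2 * r + 1)" by simp
      have "qbinom q M m = qpoch q M * u m * u (M - m)"
        using qbinom_conv_inverse[OF u, of m "M - m"] m by simp
      then have "u M * qbinom q M m = (qpoch q M * u M) * (u m * u (M - m))"
        by (simp add: algebra_simps)
      then have b: "u m * u (N - (r + m)) = u M * qbinom q M m"
        by (simp add: u M_def)
      have "signed_dirichlet t r * q ^ ((r + m) * (r + m + 1) + triangle r) * (u (r + m + 1 + r) * u m * u (N - (r + m)))
        = signed_dirichlet t r * q ^ (3 * triangle r + m * (m + (2 * r + 1))) * u (m + (2 * r + 1)) * (u m * u (N - (r + m)))"
        unfolding e e' by (simp only: mult_ac)
      then show "signed_dirichlet t r * q ^ ((r + m) * (r + m + 1) + triangle r) * (u (r + m + 1 + r) * u m * u (N - (r + m)))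
        = signed_dirichlet t r * q ^ (3 * triangle r) * u M * (q ^ (m * (m + (2 * r + 1))) * qbinom q M m * u (m + (2 * r + 1)))"
        unfolding b by (simp add: power_add algebra_simps)
    qed
    also have "\<dots> = signed_dirichlet t r * q ^ (3 * triangle r) * u M * u (M + (2 * r + 1))"
      unfolding sum_distrib_left[symmetric] durfee_sum[OF u] ..
    also have "M + (2 * r + 1) = N + r + 1" using r by (simp add: M_def)
    finally show "(\<Sum>m\<le>N - r. signed_dirichlet t r * q ^ ((r + m) * (r + m + 1) + triangle r) *
      (u (r + m + 1 + r) * u m * u (N - (r + m)))) = signed_dirichlet t r * q ^ (3 * triangle r) * u (N - r) * u (N + r + 1)"
      by (simp add: M_def)
  qed
  finally show ?thesis .
qed

section \<open>Congruences for truncated products\<close>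

definition eq_mod :: "'a::comm_ring_1 \<Rightarrow> 'a \<Rightarrow> 'a \<Rightarrow> bool" where
  "eq_mod m f g \<longleftrightarrow> m dvd f - g"

lemma eq_mod_refl [simp, intro]: "eq_mod m f f"
  by (simp add: eq_mod_def)

lemma eq_mod_sym: "eq_mod m f g \<Longrightarrow> eq_mod m g f"
  unfolding eq_mod_def by (metis dvd_minus_iff minus_diff_eq)

lemma eq_mod_trans [trans]: "eq_mod m f g \<Longrightarrow> eq_mod m g h \<Longrightarrow> eq_mod m f h"
  unfolding eq_mod_def using dvd_add[of m "f - g" "g - h"] by simp

lemma eq_mod_mult: "eq_mod m f g \<Longrightarrow> eq_mod m f' g' \<Longrightarrow> eq_mod m (f * f') (g * g')"
proof -
  assume "eq_mod m f g" "eq_mod m f' g'"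
  then have "m dvd (f - g) * f' + g * (f' - g')"
    unfolding eq_mod_def by (intro dvd_add dvd_mult dvd_mult2)
  then show ?thesis by (simp add: eq_mod_def algebra_simps)
qed

lemma eq_mod_sum: "(\<And>x. x \<in> A \<Longrightarrow> eq_mod m (f x) (g x)) \<Longrightarrow> eq_mod m (sum f A) (sum g A)"
  unfolding eq_mod_def sum_subtractf[symmetric] by (rule dvd_sum)

lemma eq_mod_dvd: "eq_mod m f g \<Longrightarrow> k dvd m \<Longrightarrow> eq_mod k f g"
  unfolding eq_mod_def by (rule dvd_trans)

text \<open>
Units may be cancelled from congruences; this replaces division by truncated infinite products.
\<close>
lemma eq_mod_cancel:
  assumes "eq_mod m (c * f) (c * g)" "c dvd 1"
  shows "eq_mod m f g"
proof -
  from \<open>c dvd 1\<close> obtain d where d: "1 = c * d" by (auto elim: dvdE)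
  have "eq_mod m (d * (c * f)) (d * (c * g))" using assms(1) by (rule eq_mod_mult[OF eq_mod_refl])
  moreover have "d * (c * x) = x" for x using d by (metis mult.assoc mult.commute mult.left_neutral)
  ultimately show ?thesis by simp
qed

lemma eq_mod_prod_truncate:
  fixes f :: "nat \<Rightarrow> 'a::comm_ring_1" and N M :: nat
  assumes "\<And>i. i > N \<Longrightarrow> eq_mod m (f i) 1" "N \<le> M"
  shows "eq_mod m (\<Prod>i=1..M. f i) (\<Prod>i=1..N. f i)"
  using assms(2)
proof (induction M rule: dec_induct)
  case (step n)
  have "eq_mod m ((\<Prod>i=1..n. f i) * f (Suc n)) ((\<Prod>i=1..N. f i) * 1)"
    using step assms(1) by (intro eq_mod_mult) auto
  then show ?case by simp
qed simp

lemma eq_mod_qpoch: "N \<le> M \<Longrightarrow> eq_mod (q ^ Suc N) (qpoch q M) (qpoch q N)"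
  unfolding qpoch_def by (rule eq_mod_prod_truncate) (auto simp: eq_mod_def simp del: power_Suc intro!: le_imp_power_dvd)

lemma eq_mod_qquad: "N \<le> M \<Longrightarrow> eq_mod (q ^ Suc N) (qquad t q M) (qquad t q N)"
  unfolding qquad_def
proof (rule eq_mod_prod_truncate)
  fix i assume "N < i"
  then have "q ^ Suc N dvd q ^ i" "q ^ Suc N dvd q ^ (2 * i)" by (auto simp del: power_Suc intro!: le_imp_power_dvd)
  then have "q ^ Suc N dvd q ^ (2 * i) - t * q ^ i" by (intro dvd_diff dvd_mult)
  then show "eq_mod (q ^ Suc N) (1 - t * q ^ i + q ^ (2 * i)) 1"
    by (simp add: eq_mod_def algebra_simps)
qed

lemma eq_mod_qpoch_inverse:
  assumes u: "\<And>n. qpoch q n * u n = 1" and "N \<le> M" "N \<le> M'"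
  shows "eq_mod (q ^ Suc N) (qpoch q M * u M') 1"
proof -
  have "eq_mod (q ^ Suc N) (qpoch q M * u M') (qpoch q M' * u M')"
    using assms(2,3)
    by (intro eq_mod_mult eq_mod_refl eq_mod_trans[OF eq_mod_qpoch eq_mod_sym[OF eq_mod_qpoch]])
  then show ?thesis by (simp add: u)
qed

text \<open>
Replacing \<open>(q;q)_N\<close> by \<open>(q;q)_(N-r)\<close> is only correct modulo \<open>q^(N-r+1)\<close>. The loss of \<open>r\<close> powers is made
good by the factor \<open>q^e\<close>, and in both expansions the exponents are at least the summation index.
\<close>
lemma eq_mod_qpoch_inverse_shift:
  assumes u: "\<And>n. qpoch q n * u n = 1" and "r \<le> N" "r \<le> e"
  shows "eq_mod (q ^ Suc N) (qpoch q N * u (N - r) * q ^ e) (q ^ e)"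
proof -
  have "q ^ Suc (N - r) dvd qpoch q N * u (N - r) - 1"
    using eq_mod_qpoch_inverse[OF u, of "N - r" N "N - r"] by (simp add: eq_mod_def)
  then have "q ^ Suc (N - r) * q ^ e dvd (qpoch q N * u (N - r) - 1) * q ^ e" by (rule mult_dvd_mono) simp
  moreover have "q ^ Suc N dvd q ^ Suc (N - r) * q ^ e"
    unfolding power_add[symmetric] using assms(2,3) by (intro le_imp_power_dvd) simp
  ultimately show ?thesis unfolding eq_mod_def by (metis dvd_trans left_diff_distrib mult_1)
qed

lemma triangle_ge: "r \<le> triangle r"
  by (induction r) auto

text \<open>
The limit of \<open>finite_triple_product\<close>, where the Gaussian binomials tend to \<open>1/(q;q)_\<infinity>\<close>.
\<close>
lemma triple_product_mod:
  assumes u: "\<And>n. qpoch q n * u n = 1"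
  shows "eq_mod (q ^ Suc N) (qpoch q N * qquad t q N) (\<Sum>r\<le>N. signed_dirichlet t r * q ^ triangle r)"
proof -
  have "qpoch q N * qquad t q N = (\<Sum>r\<le>N. signed_dirichlet t r *
      ((qpoch q (2 * N + 1) * u (N + 1 + r)) * (qpoch q N * u (N - r) * q ^ triangle r)))"
    unfolding finite_triple_product sum_distrib_left
  proof (intro sum.cong refl)
    fix r assume "r \<in> {..N}"
    then have e: "N + 1 + r + (N - r) = 2 * N + 1" by simp
    have "qbinom q (2 * N + 1) (N + 1 + r) = qpoch q (2 * N + 1) * u (N + 1 + r) * u (N - r)"
      using qbinom_conv_inverse[OF u, of "N + 1 + r" "N - r"] unfolding e .
    then show "qpoch q N * (signed_dirichlet t r * jtp_coeff q N r) = signed_dirichlet t r *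
        ((qpoch q (2 * N + 1) * u (N + 1 + r)) * (qpoch q N * u (N - r) * q ^ triangle r))"
      unfolding jtp_coeff_def by (simp only: mult_ac)
  qed
  also have "eq_mod (q ^ Suc N) \<dots> (\<Sum>r\<le>N. signed_dirichlet t r * (1 * q ^ triangle r))"
    by (rule eq_mod_sum, rule eq_mod_mult[OF eq_mod_refl],
      rule eq_mod_mult[OF eq_mod_qpoch_inverse[OF u] eq_mod_qpoch_inverse_shift[OF u]])
      (auto intro: triangle_ge)
  finally show ?thesis by simp
qed

text \<open>
The limit of \<open>bailey_transform\<close>, where all denominators that contain \<open>N\<close> tend to \<open>(q;q)_\<infinity>\<close>.
\<close>
lemma bailey_mod:
  assumes u: "\<And>n. qpoch q n * u n = 1"
  shows "eq_mod (q ^ Suc N) (qpoch q N * (\<Sum>n\<le>N. q ^ (n * (n + 1)) * qquad t q n * u (2 * n + 1)))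
    (\<Sum>r\<le>N. signed_dirichlet t r * q ^ (3 * triangle r))"
proof -
  have "eq_mod (q ^ Suc N)
      (\<Sum>n\<le>N. qpoch q N * u (N - n) * q ^ (n * (n + 1)) * (qquad t q n * u (2 * n + 1)))
      (\<Sum>n\<le>N. q ^ (n * (n + 1)) * (qquad t q n * u (2 * n + 1)))"
    by (rule eq_mod_sum, rule eq_mod_mult[OF eq_mod_qpoch_inverse_shift[OF u] eq_mod_refl]) auto
  then have "eq_mod (q ^ Suc N) (qpoch q N * (\<Sum>n\<le>N. q ^ (n * (n + 1)) * (qquad t q n * u (2 * n + 1))))
      (qpoch q N * (\<Sum>n\<le>N. qpoch q N * u (N - n) * q ^ (n * (n + 1)) * (qquad t q n * u (2 * n + 1))))"
    by (rule eq_mod_mult[OF eq_mod_refl eq_mod_sym])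
  also have "(\<Sum>n\<le>N. qpoch q N * u (N - n) * q ^ (n * (n + 1)) * (qquad t q n * u (2 * n + 1)))
      = qpoch q N * (\<Sum>n\<le>N. q ^ (n * (n + 1)) * qquad t q n * u (2 * n + 1) * u (N - n))"
    unfolding sum_distrib_left by (simp only: mult_ac)
  also have "qpoch q N * \<dots> = (\<Sum>r\<le>N. signed_dirichlet t r *
      ((qpoch q N * u (N + r + 1)) * (qpoch q N * u (N - r) * q ^ (3 * triangle r))))"
    unfolding bailey_transform[OF u] sum_distrib_left by (simp only: mult_ac)
  also have "eq_mod (q ^ Suc N) \<dots> (\<Sum>r\<le>N. signed_dirichlet t r * (1 * q ^ (3 * triangle r)))"
    by (rule eq_mod_sum, rule eq_mod_mult[OF eq_mod_refl],
      rule eq_mod_mult[OF eq_mod_qpoch_inverse[OF u] eq_mod_qpoch_inverse_shift[OF u]])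
      (auto intro: le_trans[OF triangle_ge])
  finally show ?thesis by (simp add: mult_ac)
qed

lemma eq_mod_power_mono: "eq_mod ((q ^ k) ^ Suc N) f g \<Longrightarrow> k > 0 \<Longrightarrow> eq_mod (q ^ Suc N) f g"
  unfolding power_mult[symmetric] by (erule eq_mod_dvd, rule le_imp_power_dvd) (cases k, simp_all)

text \<open>
The series \<open>\<Sum>r. c_r q^(3r(r+1)/2)\<close> in \<open>bailey_mod\<close> is the one in \<open>triple_product_mod\<close> for \<open>q^3\<close>, so both
sides of the congruence are congruent to it.
\<close>
lemma slater_sum_mod:
  assumes unit: "\<And>n. qpoch q n dvd 1" "\<And>n. qpoch (q ^ 3) n dvd 1" and u: "\<And>n. qpoch q n * u n = 1"
  shows "eq_mod (q ^ Suc N) (qpoch q N * (\<Sum>n\<le>N. q ^ (n * (n + 1)) * qquad t q n * u (2 * n + 1)))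
     (qpoch (q ^ 3) N * qquad t (q ^ 3) N)"
proof -
  have "\<forall>n. \<exists>v. qpoch (q ^ 3) n * v = 1" using unit(2) by (metis dvdE)
  then obtain v where v: "\<And>n. qpoch (q ^ 3) n * v n = 1" by metis
  have "eq_mod (q ^ Suc N) (qpoch (q ^ 3) N * qquad t (q ^ 3) N) (\<Sum>r\<le>N. signed_dirichlet t r * (q ^ 3) ^ triangle r)"
    by (rule eq_mod_power_mono[OF triple_product_mod[OF v]]) simp
  then have "eq_mod (q ^ Suc N) (\<Sum>r\<le>N. signed_dirichlet t r * q ^ (3 * triangle r)) (qpoch (q ^ 3) N * qquad t (q ^ 3) N)"
    unfolding power_mult by (rule eq_mod_sym)
  with bailey_mod[OF u] show ?thesis by (rule eq_mod_trans)
qed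

section \<open>Euler's identity and the product side\<close>

definition qplus :: "'a::comm_ring_1 \<Rightarrow> nat \<Rightarrow> 'a" where
  "qplus q n = (\<Prod>i=1..n. 1 + q ^ i)"

definition qodd :: "'a::comm_ring_1 \<Rightarrow> nat \<Rightarrow> 'a" where
  "qodd q n = (\<Prod>j<n. 1 - q ^ (2 * j + 1))"

text \<open>
The product of \<open>1 - q^m\<close> over the odd \<open>m = 2b + 1\<close> that are not divisible by 3, as 3
divides \<open>2b + 1\<close> iff \<open>b\<close> is 1 modulo 3.
\<close>
definition qodd_not3 :: "'a::comm_ring_1 \<Rightarrow> nat \<Rightarrow> 'a" where
  "qodd_not3 q n = (\<Prod>b<n. if b mod 3 = 1 then 1 else 1 - q ^ (2 * b + 1))"

text \<open>
Euler's identity between distinct and odd parts: both sides, multiplied by \<open>(q;q)_n\<close>, agree with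
\<open>(q;q)_(2n)\<close> and \<open>(q;q)_n\<close>, which differ only beyond \<open>q^n\<close>.
\<close>
lemma euler_mod:
  assumes "qpoch q n dvd 1"
  shows "eq_mod (q ^ Suc n) (qplus q n * qodd q n) 1"
proof -
  have "qpoch q n * (qplus q n * qodd q n) = qpoch q (2 * n)"
  proof (induction n)
    case (Suc n)
    have "(1 + q ^ Suc n) * (1 - q ^ Suc n) = 1 - (q ^ Suc n * q ^ Suc n)"
      by (simp only: algebra_simps mult_1_left)
    also have "q ^ Suc n * q ^ Suc n = q ^ Suc (Suc (2 * n))"
      unfolding power_add[symmetric] by (rule arg_cong[of _ _ "\<lambda>n. q ^ n"]) simp
    finally have e: "(1 + q ^ Suc n) * (1 - q ^ Suc n) = 1 - q ^ Suc (Suc (2 * n))" .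
    have "qpoch q (Suc n) * (qplus q (Suc n) * qodd q (Suc n))
      = (qpoch q n * (qplus q n * qodd q n)) * ((1 - q ^ Suc (2 * n)) * (1 - q ^ Suc (Suc (2 * n))))"
      unfolding e[symmetric] by (simp add: qpoch_Suc qplus_def qodd_def mult_ac del: power_Suc)
    also have "\<dots> = qpoch q (2 * Suc n)" unfolding Suc.IH by (simp add: qpoch_Suc mult.assoc)
    finally show ?case .
  qed (simp add: qplus_def qodd_def)
  then have "eq_mod (q ^ Suc n) (qpoch q n * (qplus q n * qodd q n)) (qpoch q n * 1)"
    by (simp add: eq_mod_qpoch del: power_Suc)
  then show ?thesis using assms by (rule eq_mod_cancel)
qed

lemma eq_mod_qplus: "N \<le> M \<Longrightarrow> eq_mod (q ^ Suc N) (qplus q M) (qplus q N)"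
  unfolding qplus_def by (rule eq_mod_prod_truncate) (auto simp: eq_mod_def simp del: power_Suc intro!: le_imp_power_dvd)

text \<open>
The sum of two cubes, \<open>(1 - x + x^2) (1 + x) = 1 + x^3\<close>, in each factor.
\<close>
lemma qquad_1_mult_qplus: "qquad 1 q n * qplus q n = qplus (q ^ 3) n"
proof -
  have "(1 - 1 * q ^ i + q ^ (2 * i)) * (1 + q ^ i) = 1 + (q ^ 3) ^ i" for i
  proof -
    have "q ^ (2 * i) = (q ^ i) ^ 2" "(q ^ 3) ^ i = (q ^ i) ^ 3"
      by (metis power_mult mult.commute)+
    then show ?thesis by (simp add: algebra_simps power2_eq_square power3_eq_cube)
  qed
  then show ?thesis by (simp add: qquad_def qplus_def prod.distrib[symmetric])
qed

lemma qodd_split3: "qodd q (3 * n) = qodd_not3 q (3 * n) * qodd (q ^ 3) n"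
proof (induction n)
  case (Suc n)
  have e: "3 * Suc n = Suc (Suc (Suc (3 * n)))" by simp
  have p: "q ^ (2 * Suc (3 * n) + 1) = (q ^ 3) ^ (2 * n + 1)"
    unfolding power_mult[symmetric] by (rule arg_cong[of _ _ "\<lambda>n. q ^ n"]) simp
  have m: "3 * n mod 3 = 0" "Suc (3 * n) mod 3 = 1" "Suc (Suc (3 * n)) mod 3 = 2" by presburger+
  have "qodd q (3 * Suc n) = qodd q (3 * n) * (1 - q ^ (2 * (3 * n) + 1)) *
      (1 - q ^ (2 * Suc (3 * n) + 1)) * (1 - q ^ (2 * Suc (Suc (3 * n)) + 1))"
    unfolding e qodd_def by (simp only: prod.lessThan_Suc)
  also have "\<dots> = (qodd_not3 q (3 * n) * (1 - q ^ (2 * (3 * n) + 1)) * 1 * (1 - q ^ (2 * Suc (Suc (3 * n)) + 1)))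
       * (qodd (q ^ 3) n * (1 - (q ^ 3) ^ (2 * n + 1)))"
    unfolding Suc.IH p by (simp only: mult_ac mult_1)
  also have "\<dots> = qodd_not3 q (3 * Suc n) * qodd (q ^ 3) (Suc n)"
    unfolding e qodd_not3_def qodd_def prod.lessThan_Suc m by simp
  finally show ?case .
qed (simp add: qodd_def qodd_not3_def)

text \<open>
Euler's identity, for \<open>q\<close> and for \<open>q^3\<close>, turns \<open>\<Prod>i. (1+q^(3i))/(1+q^i)\<close> into the quotient of the products
of \<open>1 - q^m\<close> over odd \<open>m\<close> and over odd multiples \<open>m\<close> of 3. The upper limits \<open>3n\<close> and \<open>n\<close> match this
splitting modulo 3.
\<close>
lemma qquad_1_mod:
  assumes unit: "\<And>n. qpoch q n dvd 1" "\<And>n. qpoch (q ^ 3) n dvd 1"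
  shows "eq_mod (q ^ Suc n) (qquad 1 q n) (qodd_not3 q (3 * n))"
proof -
  let ?B = "qodd_not3 q (3 * n)" and ?O = "qodd (q ^ 3) n"
  have "eq_mod (q ^ Suc (3 * n)) (qplus q (3 * n) * (?B * ?O)) 1"
    using euler_mod[OF unit(1), of "3 * n"] by (simp only: qodd_split3)
  then have 1: "eq_mod (q ^ Suc n) (qplus q (3 * n) * (?B * ?O)) 1"
    by (rule eq_mod_dvd, intro le_imp_power_dvd) simp
  have 2: "eq_mod (q ^ Suc n) (qplus (q ^ 3) (3 * n)) (qplus (q ^ 3) n)"
    by (rule eq_mod_power_mono[OF eq_mod_qplus]) simp_all
  have 3: "eq_mod (q ^ Suc n) (qplus (q ^ 3) n * ?O) 1"
    by (rule eq_mod_power_mono[OF euler_mod[OF unit(2)]]) simp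
  have "eq_mod (q ^ Suc n) (qquad 1 q n * 1) (qquad 1 q (3 * n) * (qplus q (3 * n) * (?B * ?O)))"
    by (intro eq_mod_mult eq_mod_sym[OF 1] eq_mod_sym[OF eq_mod_qquad]) simp
  also have "\<dots> = qplus (q ^ 3) (3 * n) * ?O * ?B"
    unfolding qquad_1_mult_qplus[symmetric] by (simp only: mult_ac)
  also have "eq_mod (q ^ Suc n) \<dots> (qplus (q ^ 3) n * ?O * ?B)"
    by (intro eq_mod_mult 2 eq_mod_refl)
  also have "eq_mod (q ^ Suc n) \<dots> (1 * ?B)"
    by (intro eq_mod_mult 3 eq_mod_refl)
  finally show ?thesis by simp
qed

lemma qpoch_split3:
  "qpoch q (3 * n) = (\<Prod>b<n. (1 - q ^ (3 * b + 1)) * (1 - q ^ (3 * b + 2))) * qpoch (q ^ 3) n"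
proof (induction n)
  case (Suc n)
  have e: "3 * Suc n = Suc (Suc (Suc (3 * n)))" by simp
  have p: "q ^ Suc (Suc (Suc (3 * n))) = (q ^ 3) ^ Suc n"
    unfolding power_mult[symmetric] by (rule arg_cong[of _ _ "\<lambda>n. q ^ n"]) simp
  show ?case
    unfolding e qpoch_Suc Suc.IH p by (simp add: algebra_simps)
qed simp

text \<open>
The identity behind the theorem. The hypothesis on \<open>R\<close> describes the generating function of the
partitions on the right-hand side whose parts are below \<open>9N\<close>.
\<close>
lemma slater_identity_mod:
  assumes unit: "\<And>n. qpoch q n dvd 1" "\<And>n. qpoch (q ^ 3) n dvd 1" "\<And>n. qpoch ((q ^ 3) ^ 3) n dvd 1"
    and u: "\<And>n. qpoch q n * u n = 1"
    and R: "R * (\<Prod>b<3 * N. (1 - q ^ (3 * b + 1)) * (1 - q ^ (3 * b + 2))) = qodd_not3 (q ^ 3) (3 * N)"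
  shows "eq_mod (q ^ Suc N) (\<Sum>n\<le>N. q ^ (n * (n + 1)) * qquad 1 q n * u (2 * n + 1)) R"
proof (rule eq_mod_cancel[OF _ unit(1)])
  have "eq_mod (q ^ Suc N) (qpoch q N * (\<Sum>n\<le>N. q ^ (n * (n + 1)) * qquad 1 q n * u (2 * n + 1)))
     (qpoch (q ^ 3) N * qquad 1 (q ^ 3) N)"
    by (rule slater_sum_mod[OF unit(1,2) u])
  also have "eq_mod (q ^ Suc N) \<dots> (qpoch (q ^ 3) (3 * N) * qodd_not3 (q ^ 3) (3 * N))"
    by (rule eq_mod_power_mono[where k = 3], intro eq_mod_mult eq_mod_sym[OF eq_mod_qpoch] qquad_1_mod unit) simp_all
  also have "\<dots> = qpoch q (3 * (3 * N)) * R"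
    unfolding qpoch_split3[of q "3 * N"] R[symmetric] by (simp only: mult_ac)
  also have "eq_mod (q ^ Suc N) \<dots> (qpoch q N * R)"
    by (intro eq_mod_mult eq_mod_qpoch eq_mod_refl) simp
  finally show "eq_mod (q ^ Suc N) (qpoch q N * (\<Sum>n\<le>N. q ^ (n * (n + 1)) * qquad 1 q n * u (2 * n + 1)))
      (qpoch q N * R)" .
qed

section \<open>Generating functions of multisets\<close>

definition gf :: "'a set \<Rightarrow> ('a \<Rightarrow> nat) \<Rightarrow> rat fps" where
  "gf S w = Abs_fps (\<lambda>n. of_nat (card {x \<in> S. w x = n}))"

text \<open>
As infinite sets have cardinality 0, sums and products of generating functions count correctly only
if every coefficient counts a finite set.
\<close>
definition finite_fibres :: "'a set \<Rightarrow> ('a \<Rightarrow> nat) \<Rightarrow> bool" where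
  "finite_fibres S w \<longleftrightarrow> (\<forall>n. finite {x \<in> S. w x = n})"

lemma gf_nth: "fps_nth (gf S w) n = of_nat (card {x \<in> S. w x = n})"
  by (simp add: gf_def)

lemma finite_fibres_subset: "finite_fibres T w \<Longrightarrow> S \<subseteq> T \<Longrightarrow> finite_fibres S w"
  unfolding finite_fibres_def by (auto intro: finite_subset[of "{x \<in> S. w x = n}" "{x \<in> T. w x = n}" for n])

lemma finite_fibres_finite: "finite S \<Longrightarrow> finite_fibres S w"
  by (simp add: finite_fibres_def)

lemma gf_bij:
  assumes "bij_betw f S T" "\<And>x. x \<in> S \<Longrightarrow> v (f x) = w x"
  shows "gf S w = gf T v"
proof (rule fps_ext)
  fix n
  have "bij_betw f {x \<in> S. w x = n} {y \<in> T. v y = n}"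
    using assms unfolding bij_betw_def by (auto simp: inj_on_def)
  then show "fps_nth (gf S w) n = fps_nth (gf T v) n"
    by (simp add: gf_nth bij_betw_same_card)
qed

lemma gf_Un:
  assumes "finite_fibres S w" "finite_fibres T w" "S \<inter> T = {}"
  shows "gf (S \<union> T) w = gf S w + gf T w"
proof (rule fps_ext)
  fix n
  have "{x \<in> S \<union> T. w x = n} = {x \<in> S. w x = n} \<union> {x \<in> T. w x = n}" by auto
  moreover have "card \<dots> = card {x \<in> S. w x = n} + card {x \<in> T. w x = n}"
    using assms by (intro card_Un_disjoint) (auto simp: finite_fibres_def)
  ultimately show "fps_nth (gf (S \<union> T) w) n = fps_nth (gf S w + gf T w) n"
    by (simp add: gf_nth)
qed

lemma gf_shift: "gf S (\<lambda>x. d + w x) = fps_X ^ d * gf S w"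
proof (rule fps_ext)
  fix n
  have "{x \<in> S. d + w x = n} = (if n < d then {} else {x \<in> S. w x = n - d})" by auto
  then show "fps_nth (gf S (\<lambda>x. d + w x)) n = fps_nth (fps_X ^ d * gf S w) n"
    by (simp add: gf_nth fps_X_power_mult_nth)
qed

lemma gf_Times:
  assumes "finite_fibres S w" "finite_fibres T v"
  shows "gf (S \<times> T) (\<lambda>(x, y). w x + v y) = gf S w * gf T v"
proof (rule fps_ext)
  fix n
  have "{z \<in> S \<times> T. (case z of (x, y) \<Rightarrow> w x + v y) = n}
      = (\<Union>i\<in>{0..n}. {x \<in> S. w x = i} \<times> {y \<in> T. v y = n - i})"
    by auto
  moreover have "card \<dots> = (\<Sum>i=0..n. card ({x \<in> S. w x = i} \<times> {y \<in> T. v y = n - i}))"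
    using assms by (intro card_UN_disjoint) (auto simp: finite_fibres_def)
  ultimately show "fps_nth (gf (S \<times> T) (\<lambda>(x, y). w x + v y)) n = fps_nth (gf S w * gf T v) n"
    by (simp add: gf_nth fps_mult_nth card_cartesian_product)
qed

text \<open>
The geometric series: either \<open>c\<close> is 0, or \<open>c\<close> is a successor and accounts for an additional factor \<open>X^d\<close>.
\<close>
lemma gf_multiples:
  assumes "d > 0"
  shows "gf UNIV (\<lambda>c. d * c) * (1 - fps_X ^ d) = 1"
proof -
  have fin: "finite_fibres UNIV (\<lambda>c. d * c)"
    unfolding finite_fibres_def
  proof
    fix n show "finite {x \<in> UNIV. d * x = n}"
      by (rule finite_subset[of _ "{..n}"]) (use assms in auto)
  qed
  have U: "(UNIV :: nat set) = {0} \<union> range Suc" using not0_implies_Suc by auto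
  have "gf UNIV (\<lambda>c. d * c) = gf ({0} \<union> range Suc) (\<lambda>c. d * c)"
    by (rule arg_cong[OF U])
  also have "\<dots> = gf {0} (\<lambda>c. d * c) + gf (range Suc) (\<lambda>c. d * c)"
    by (intro gf_Un finite_fibres_subset[OF fin]) auto
  also have "gf (range Suc) (\<lambda>c. d * c) = gf UNIV (\<lambda>c. d + d * c)"
    by (rule gf_bij[symmetric, of Suc]) (auto simp: bij_betw_def)
  also have "\<dots> = fps_X ^ d * gf UNIV (\<lambda>c. d * c)" by (rule gf_shift)
  also have "gf {0} (\<lambda>c. d * c) = 1"
  proof (rule fps_ext)
    fix n
    have "{x \<in> {0}. d * x = n} = (if n = 0 then {0} else {})" by auto
    then show "fps_nth (gf {0} (\<lambda>c. d * c)) n = fps_nth 1 n" by (simp add: gf_nth)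
  qed
  finally show ?thesis by (simp add: algebra_simps)
qed

lemma gf_finite: "finite S \<Longrightarrow> gf S w = (\<Sum>x\<in>S. fps_X ^ w x)"
  by (rule fps_ext) (auto simp: gf_nth fps_sum_nth fps_X_power_nth sum.If_cases Int_def intro!: arg_cong[of _ _ card])

text \<open>
All parts, and their number, are bounded by the sum when 0 is not a part.
\<close>
lemma finite_fibres_sum_mset: "finite_fibres {M. 0 \<notin># M} (sum_mset :: nat multiset \<Rightarrow> nat)"
  unfolding finite_fibres_def
proof
  fix n
  show "finite {M \<in> {M. 0 \<notin># M}. sum_mset M = (n::nat)}"
  proof (rule finite_subset)
    show "finite (mset ` {xs. set xs \<subseteq> {..n} \<and> length xs \<le> n})"
      by (intro finite_imageI finite_lists_length_le) simp
    show "{M \<in> {M. 0 \<notin># M}. sum_mset M = n} \<subseteq> mset ` {xs. set xs \<subseteq> {..n} \<and> length xs \<le> n}"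
    proof
      fix M :: "nat multiset" assume M: "M \<in> {M \<in> {M. 0 \<notin># M}. sum_mset M = n}"
      obtain xs where xs: "M = mset xs" by (metis ex_mset)
      have "length ys \<le> sum_list ys" if "0 \<notin> set ys" for ys :: "nat list"
        using that by (induction ys) auto
      then show "M \<in> mset ` {xs. set xs \<subseteq> {..n} \<and> length xs \<le> n}"
        using M xs member_le_sum_list[of _ xs] by (auto simp: sum_mset_sum_list intro!: image_eqI[of _ _ xs])
    qed
  qed
qed

text \<open>
A multiset over a disjoint union is determined by its two restrictions, which are independent of each
other, and its sum is the sum of theirs.
\<close>
lemma gf_add_mset:
  assumes S: "\<And>M. M \<in> S \<Longrightarrow> set_mset M \<subseteq> A" and T: "\<And>M. M \<in> T \<Longrightarrow> set_mset M \<subseteq> B"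
    and AB: "A \<inter> B = {}" "0 \<notin> A" "0 \<notin> B"
  shows "gf {M. set_mset M \<subseteq> A \<union> B \<and> filter_mset (\<lambda>x. x \<in> A) M \<in> S \<and> filter_mset (\<lambda>x. x \<in> B) M \<in> T} sum_mset
    = gf S sum_mset * gf T sum_mset"
proof -
  let ?U = "{M. set_mset M \<subseteq> A \<union> B \<and> filter_mset (\<lambda>x. x \<in> A) M \<in> S \<and> filter_mset (\<lambda>x. x \<in> B) M \<in> T}"
  have left: "filter_mset (\<lambda>x. x \<in> A) (M + N) = M" "filter_mset (\<lambda>x. x \<in> B) (M + N) = N"
    if "M \<in> S" "N \<in> T" for M N
    using S[OF that(1)] T[OF that(2)] AB(1)
    by (auto simp: multiset_eq_iff count_eq_zero_iff)
  have right: "filter_mset (\<lambda>x. x \<in> A) M + filter_mset (\<lambda>x. x \<in> B) M = M" if "set_mset M \<subseteq> A \<union> B" for M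
  proof (rule multiset_eqI)
    fix x
    show "count (filter_mset (\<lambda>x. x \<in> A) M + filter_mset (\<lambda>x. x \<in> B) M) x = count M x"
      using that AB(1) by (auto simp: count_eq_zero_iff)
  qed
  have "gf (S \<times> T) (\<lambda>(M, N). sum_mset M + sum_mset N) = gf ?U sum_mset"
  proof (rule gf_bij[of "\<lambda>(M, N). M + N"])
    show "bij_betw (\<lambda>(M, N). M + N) (S \<times> T) ?U"
    proof (rule bij_betw_byWitness[where f' = "\<lambda>M. (filter_mset (\<lambda>x. x \<in> A) M, filter_mset (\<lambda>x. x \<in> B) M)"])
      show "(\<lambda>(M, N). M + N) ` (S \<times> T) \<subseteq> ?U"
        using left S T by (fastforce simp del: filter_union_mset)
    qed (use left right in \<open>auto simp del: filter_union_mset\<close>)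
  qed auto
  moreover have "gf (S \<times> T) (\<lambda>(M, N). sum_mset M + sum_mset N) = gf S sum_mset * gf T sum_mset"
    using S T AB by (intro gf_Times finite_fibres_subset[OF finite_fibres_sum_mset]) auto
  ultimately show ?thesis by simp
qed

text \<open>
Multisets whose parts come in blocks \<open>A j\<close>, with an independent condition \<open>S j\<close> on the parts within each
block. Both sides of the theorem have this form: the blocks are single parts on the left and the pairs
\<open>3b + 1, 3b + 2\<close> on the right.
\<close>
definition mset_family :: "'i set \<Rightarrow> ('i \<Rightarrow> nat set) \<Rightarrow> ('i \<Rightarrow> nat multiset set) \<Rightarrow> nat multiset set" where
  "mset_family J A S = {M. set_mset M \<subseteq> (\<Union>j\<in>J. A j) \<and> (\<forall>j\<in>J. filter_mset (\<lambda>x. x \<in> A j) M \<in> S j)}"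

lemma gf_mset_family:
  assumes "finite J" "disjoint_family_on A J" "\<And>j. j \<in> J \<Longrightarrow> 0 \<notin> A j"
    "\<And>j M. j \<in> J \<Longrightarrow> M \<in> S j \<Longrightarrow> set_mset M \<subseteq> A j"
  shows "gf (mset_family J A S) sum_mset = (\<Prod>j\<in>J. gf (S j) sum_mset)"
  using assms
proof (induction J rule: finite_induct)
  case empty
  have "mset_family {} A S = {{#}}" by (auto simp: mset_family_def)
  moreover have "gf {{#}} sum_mset = 1" by (simp add: gf_finite)
  ultimately show ?case by simp
next
  case (insert a J)
  let ?B = "\<Union>j\<in>J. A j"
  have disj: "A a \<inter> A j = {}" if "j \<in> J" for j
    using insert.prems(1) insert.hyps(2) that unfolding disjoint_family_on_def by (metis insertCI)
  have "mset_family (insert a J) A S = {M. set_mset M \<subseteq> A a \<union> ?B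
      \<and> filter_mset (\<lambda>x. x \<in> A a) M \<in> S a \<and> filter_mset (\<lambda>x. x \<in> ?B) M \<in> mset_family J A S}"
  proof -
    have "filter_mset (\<lambda>x. x \<in> A j) (filter_mset (\<lambda>x. x \<in> ?B) M) = filter_mset (\<lambda>x. x \<in> A j) M" if "j \<in> J" for j M
      using that by (auto simp: filter_filter_mset intro!: filter_mset_cong)
    then show ?thesis by (auto simp: mset_family_def)
  qed
  also have "gf \<dots> sum_mset = gf (S a) sum_mset * gf (mset_family J A S) sum_mset"
  proof (rule gf_add_mset)
    show "A a \<inter> ?B = {}" using disj by blast
    show "0 \<notin> A a" "0 \<notin> ?B" "\<And>M. M \<in> S a \<Longrightarrow> set_mset M \<subseteq> A a"
      using insert.prems(2,3) by auto
  qed (simp add: mset_family_def)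
  also have "gf (mset_family J A S) sum_mset = (\<Prod>j\<in>J. gf (S j) sum_mset)"
    using insert.prems by (intro insert.IH) (auto simp: disjoint_family_on_def)
  finally show ?case using insert.hyps by simp
qed

lemma gf_replicate_mset:
  assumes "x > 0"
  shows "gf ((\<lambda>c. replicate_mset c x) ` C) sum_mset = gf C (\<lambda>c. x * c)"
proof (rule gf_bij[symmetric, of "\<lambda>c. replicate_mset c x"])
  have "inj_on (\<lambda>c. replicate_mset c x) C" by (metis inj_onI size_replicate_mset)
  then show "bij_betw (\<lambda>c. replicate_mset c x) C ((\<lambda>c. replicate_mset c x) ` C)" by (simp add: bij_betw_def)
qed simp

lemma gf_single:
  assumes "x > 0"
  shows "gf {M. set_mset M \<subseteq> {x}} sum_mset * (1 - fps_X ^ x) = 1"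
proof -
  have "{M. set_mset M \<subseteq> {x}} = range (\<lambda>c. replicate_mset c x)"
    by (auto dest!: set_mset_subset_singletonD split: if_splits)
  then show ?thesis using gf_replicate_mset[OF assms, of UNIV] gf_multiples[OF assms] by simp
qed

lemma gf_pair:
  assumes "x > 0" "y > 0" "x \<noteq> y"
  shows "gf {M. set_mset M \<subseteq> {x, y}} sum_mset * ((1 - fps_X ^ x) * (1 - fps_X ^ y)) = 1"
proof -
  let ?S = "{M. set_mset M \<subseteq> {x}}" and ?T = "{M. set_mset M \<subseteq> {y}}"
  have "{M. set_mset M \<subseteq> {x, y}} = {M. set_mset M \<subseteq> {x} \<union> {y} \<and>
      filter_mset (\<lambda>z. z \<in> {x}) M \<in> ?S \<and> filter_mset (\<lambda>z. z \<in> {y}) M \<in> ?T}"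
    by auto
  also have "gf \<dots> sum_mset = gf ?S sum_mset * gf ?T sum_mset"
    using assms by (intro gf_add_mset) auto
  also have "\<dots> * ((1 - fps_X ^ x) * (1 - fps_X ^ y))
     = (gf ?S sum_mset * (1 - fps_X ^ x)) * (gf ?T sum_mset * (1 - fps_X ^ y))"
    by (simp only: mult_ac)
  finally show ?thesis using gf_single[OF assms(1)] gf_single[OF assms(2)] by simp
qed

text \<open>
A multiset that contains both \<open>x\<close> and \<open>y\<close> arises in exactly one way by adding these two to an arbitrary
one. So those that contain both account for the fraction \<open>X^(x+y)\<close> of the full generating function.
\<close>
lemma gf_pair_not_both:
  assumes "x > 0" "y > 0" "x \<noteq> y"
  shows "gf {M. set_mset M \<subseteq> {x, y} \<and> \<not> (x \<in># M \<and> y \<in># M)} sum_mset * ((1 - fps_X ^ x) * (1 - fps_X ^ y))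
     = 1 - fps_X ^ (x + y)"
proof -
  let ?all = "{M. set_mset M \<subseteq> {x, y}}"
  let ?nb = "{M. set_mset M \<subseteq> {x, y} \<and> \<not> (x \<in># M \<and> y \<in># M)}"
  let ?b = "{M. set_mset M \<subseteq> {x, y} \<and> x \<in># M \<and> y \<in># M}"
  have "gf ?all sum_mset = gf (?nb \<union> ?b) sum_mset" by (rule arg_cong[of _ _ "\<lambda>S. gf S sum_mset"]) auto
  also have "\<dots> = gf ?nb sum_mset + gf ?b sum_mset"
    using assms by (intro gf_Un finite_fibres_subset[OF finite_fibres_sum_mset]) auto
  also have "gf ?b sum_mset = gf ?all (\<lambda>M. (x + y) + sum_mset M)"
  proof (rule gf_bij[symmetric])
    show "bij_betw (\<lambda>M. add_mset x (add_mset y M)) ?all ?b"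
    proof (rule bij_betw_byWitness[where f' = "\<lambda>M. M - {#x#} - {#y#}"])
      show "\<forall>M\<in>?b. add_mset x (add_mset y (M - {#x#} - {#y#})) = M"
      proof
        fix M assume M: "M \<in> ?b"
        then have "y \<in># M - {#x#}" using assms(3) by (simp add: in_diff_count)
        then show "add_mset x (add_mset y (M - {#x#} - {#y#})) = M" using M by (simp only: insert_DiffM mem_Collect_eq)
      qed
      show "(\<lambda>M. M - {#x#} - {#y#}) ` ?b \<subseteq> ?all" by (auto dest: in_diffD)
    qed auto
  qed simp
  also have "\<dots> = fps_X ^ (x + y) * gf ?all sum_mset" by (rule gf_shift)
  finally have "gf ?nb sum_mset = gf ?all sum_mset - fps_X ^ (x + y) * gf ?all sum_mset"
    unfolding eq_diff_eq by (rule sym)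
  then have "gf ?nb sum_mset = (1 - fps_X ^ (x + y)) * gf ?all sum_mset" by (simp only: left_diff_distrib mult_1_left)
  then show ?thesis using gf_pair[OF assms] by (simp only: mult.assoc mult_1_right)
qed

section \<open>The two families of partitions\<close>

text \<open>
The inverse map lists the elements of a multiset in decreasing order.
\<close>
lemma is_partition_bij_mset:
  "bij_betw mset {p. is_partition p \<and> P (mset p)} {M. 0 \<notin># M \<and> P M}"
proof (rule bij_betw_byWitness[where f' = "\<lambda>M. rev (sorted_list_of_multiset M)"])
  have srt: "sorted_wrt (\<ge>) p \<longleftrightarrow> sorted (rev p)" for p :: "nat list"
    by (simp add: sorted_wrt_rev)
  show "\<forall>p\<in>{p. is_partition p \<and> P (mset p)}. rev (sorted_list_of_multiset (mset p)) = p"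
  proof
    fix p assume "p \<in> {p. is_partition p \<and> P (mset p)}"
    then have "sorted (rev p)" by (simp add: is_partition_def srt)
    then have "sort p = rev p" by (intro properties_for_sort) auto
    then show "rev (sorted_list_of_multiset (mset p)) = p" by simp
  qed
  show "(\<lambda>M. rev (sorted_list_of_multiset M)) ` {M. 0 \<notin># M \<and> P M} \<subseteq> {p. is_partition p \<and> P (mset p)}"
    by (auto simp: is_partition_def srt intro: gr0I)
qed (auto simp: is_partition_def)

definition positive_msets :: "nat \<Rightarrow> nat multiset set" where
  "positive_msets k = {M. set_mset M \<subseteq> {1..2 * k + 1} \<and>
     (\<forall>i\<in>{1..k}. even (count M i) \<and> count M i \<ge> 2) \<and> (\<forall>i\<in>{k + 1..2 * k + 1}. count M i \<ge> 1)}"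

definition negative_msets :: "nat \<Rightarrow> nat multiset set" where
  "negative_msets k = {N. size N = k \<and>
     (\<forall>x\<in>#N. x mod 3 = 1 \<and> x \<le> 3 * k + 1 \<and> (x > 1 \<longrightarrow> count N x \<le> 1))}"

text \<open>
The multiset of \<open>k\<close> negative parts whose parts greater than 1 are the \<open>3i + 1\<close> with \<open>i\<close> outside \<open>D\<close>: for
each missing \<open>3i + 1\<close> there is a part 1 instead.
\<close>
definition negative_of :: "nat \<Rightarrow> nat set \<Rightarrow> nat multiset" where
  "negative_of k D = mset_set ((\<lambda>i. 3 * i + 1) ` ({1..k} - D)) + replicate_mset (card D) 1"

lemma count_negative_of:
  assumes "D \<subseteq> {1..k}"
  shows "count (negative_of k D) x =
    (if x = 1 then card D else if x mod 3 = 1 \<and> x div 3 \<in> {1..k} - D then 1 else 0)"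
proof -
  have "x \<in> (\<lambda>i. 3 * i + 1) ` ({1..k} - D) \<longleftrightarrow> x mod 3 = 1 \<and> x div 3 \<in> {1..k} - D"
  proof
    assume "x mod 3 = 1 \<and> x div 3 \<in> {1..k} - D"
    then show "x \<in> (\<lambda>i. 3 * i + 1) ` ({1..k} - D)"
      by (intro image_eqI[of _ _ "x div 3"]) (auto, presburger)
  next
    assume "x \<in> (\<lambda>i. 3 * i + 1) ` ({1..k} - D)"
    then obtain i where i: "i \<in> {1..k} - D" "x = 3 * i + 1" by auto
    have "x mod 3 = 1" "x div 3 = i" unfolding i(2) by presburger+
    with i show "x mod 3 = 1 \<and> x div 3 \<in> {1..k} - D" by simp
  qed
  then show ?thesis by (auto simp: negative_of_def)
qed

lemma sum_mset_mset_set: "sum_mset (mset_set A) = \<Sum>A" for A :: "nat set"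
  by (metis sum_unfold_sum_mset image_mset.identity id_apply id_def image_mset_cong)

text \<open>
Each \<open>i\<close> in \<open>{1..k}\<close> contributes \<open>3i + 1\<close>, either as a part or, if it lies in \<open>D\<close>, as a part 1 together with
the summand \<open>3i\<close>.
\<close>
lemma sum_negative_of:
  assumes "D \<subseteq> {1..k}"
  shows "sum_mset (negative_of k D) + 3 * \<Sum>D = k + 3 * triangle k"
proof -
  have inj: "inj_on (\<lambda>i::nat. 3 * i + 1) A" for A by (simp add: inj_on_def)
  have fin: "finite D" using assms by (rule finite_subset) simp
  have "sum_mset (negative_of k D) + 3 * \<Sum>D = (\<Sum>i\<in>{1..k} - D. 3 * i + 1) + (card D + 3 * \<Sum>D)"
    unfolding negative_of_def sum_mset.union sum_mset_mset_set sum.reindex[OF inj] by simp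
  also have "card D + 3 * \<Sum>D = (\<Sum>i\<in>D. 3 * i + 1)"
    by (simp add: sum_Suc sum_distrib_left)
  also have "(\<Sum>i\<in>{1..k} - D. 3 * i + 1) + (\<Sum>i\<in>D. 3 * i + 1) = (\<Sum>i=1..k. 3 * i + 1)"
    using assms by (simp add: sum.subset_diff[symmetric] del: sum.op_ivl_Suc)
  also have "\<dots> = k + 3 * triangle k" by (induction k) auto
  finally show ?thesis .
qed

text \<open>
The inverse map collects the indices \<open>i\<close> for which \<open>3i + 1\<close> is missing. It determines the multiplicities of
all parts other than 1, and that of 1 then follows because there are \<open>k\<close> parts in all.
\<close>
lemma bij_negative_of: "bij_betw (negative_of k) (Pow {1..k}) (negative_msets k)"
proof (rule bij_betw_byWitness[where f' = "\<lambda>N. {i\<in>{1..k}. 3 * i + 1 \<notin># N}"])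
  have div3: "(3 * i + 1) mod 3 = (1::nat)" "(3 * i + 1) div 3 = i" for i :: nat by presburger+
  show "\<forall>D\<in>Pow {1..k}. {i\<in>{1..k}. 3 * i + 1 \<notin># negative_of k D} = D"
  proof
    fix D assume "D \<in> Pow {1..k}"
    then have D: "D \<subseteq> {1..k}" by simp
    then show "{i\<in>{1..k}. 3 * i + 1 \<notin># negative_of k D} = D"
      using div3 by (auto simp: count_eq_zero_iff[symmetric] count_negative_of[OF D] split: if_splits)
  qed
  show "negative_of k ` Pow {1..k} \<subseteq> negative_msets k"
  proof
    fix N assume "N \<in> negative_of k ` Pow {1..k}"
    then obtain D where D: "D \<subseteq> {1..k}" "N = negative_of k D" by auto
    have fin: "finite D" using D(1) by (rule finite_subset) simp
    have inj: "inj_on (\<lambda>i::nat. 3 * i + 1) A" for A by (simp add: inj_on_def)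
    have "card ((\<lambda>i. 3 * i + 1) ` ({1..k} - D)) = k - card D"
      unfolding card_image[OF inj] using D(1) fin by (simp add: card_Diff_subset)
    then have "size N = k"
      using D(2) card_mono[OF _ D(1)] by (simp add: negative_of_def)
    moreover have "x mod 3 = 1 \<and> x \<le> 3 * k + 1 \<and> (x > 1 \<longrightarrow> count N x \<le> 1)" if "x \<in># N" for x
    proof -
      have "count N x > 0" using that by simp
      then have "x = 1 \<or> x \<noteq> 1 \<and> x mod 3 = 1 \<and> x div 3 \<in> {1..k}"
        unfolding D(2) count_negative_of[OF D(1)] by (auto split: if_splits)
      moreover have "x \<le> 3 * k + 1" if "x mod 3 = 1" "x div 3 \<le> k" using that by presburger
      ultimately show ?thesis
        unfolding D(2) count_negative_of[OF D(1)] by auto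
    qed
    ultimately show "N \<in> negative_msets k" by (simp add: negative_msets_def)
  qed
  show "\<forall>N\<in>negative_msets k. negative_of k {i\<in>{1..k}. 3 * i + 1 \<notin># N} = N"
  proof
    fix N assume N: "N \<in> negative_msets k"
    define D where "D = {i\<in>{1..k}. 3 * i + 1 \<notin># N}"
    have D: "D \<subseteq> {1..k}" by (auto simp: D_def)
    \<comment> \<open>The multiplicity of 1 will follow from these, as both multisets have size \<open>k\<close>.\<close>
    have other: "count N x = count (negative_of k D) x" if "x \<noteq> 1" for x
    proof (cases "x \<in># N")
      case True
      with N have x: "x mod 3 = 1" "x \<le> 3 * k + 1" "x > 1 \<longrightarrow> count N x \<le> 1" by (auto simp: negative_msets_def)
      then have "x > 1" "x = 3 * (x div 3) + 1" using that by presburger+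
      then have "x div 3 \<in> {1..k}" "x div 3 \<notin> D" using x True by (auto simp: D_def)
      moreover have "count N x = 1" using x(3) \<open>x > 1\<close> True by (simp add: le_antisym Suc_leI)
      ultimately show ?thesis using that x by (simp add: count_negative_of[OF D])
    next
      case False
      have "(x mod 3 = 1 \<and> x div 3 \<in> {1..k} - D) = False"
      proof (unfold eq_False, rule notI)
        assume a: "x mod 3 = 1 \<and> x div 3 \<in> {1..k} - D"
        then have "x mod 3 = 1" by simp
        then have "x = 3 * (x div 3) + 1" by presburger
        with a False show False by (auto simp: D_def)
      qed
      moreover have "count N x = 0" using False by (rule not_in_iff[THEN iffD1])
      ultimately show ?thesis using that by (simp only: count_negative_of[OF D] if_False)
    qed
    have "negative_of k D \<in> negative_msets k"
      using \<open>negative_of k ` Pow {1..k} \<subseteq> negative_msets k\<close> D by blast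
    then have eq_size: "size N = size (negative_of k D)" using N by (simp add: negative_msets_def)
    have size: "size M = count M 1 + size (filter_mset (\<lambda>x. x \<noteq> 1) M)" for M :: "nat multiset"
      by (induction M) auto
    have "filter_mset (\<lambda>x. x \<noteq> 1) N = filter_mset (\<lambda>x. x \<noteq> 1) (negative_of k D)"
      using other by (simp add: multiset_eq_iff)
    then have "size (filter_mset (\<lambda>x. x \<noteq> 1) N) = size (filter_mset (\<lambda>x. x \<noteq> 1) (negative_of k D))"
      by (rule arg_cong)
    with eq_size size[of N] size[of "negative_of k D"] have "count N 1 = count (negative_of k D) 1"
      by linarith
    with other have "count (negative_of k D) x = count N x" for x by (cases "x = 1") simp_all
    then have "negative_of k D = N" by (rule multiset_eqI)
    then show "negative_of k {i\<in>{1..k}. 3 * i + 1 \<notin># N} = N" by (simp add: D_def)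
  qed
qed auto

lemma gf_subset_sums: "gf (Pow {1..k}) (\<lambda>D. 3 * \<Sum>D) = qplus (fps_X ^ 3) k"
proof -
  have "qplus (fps_X ^ 3) k = (\<Prod>i=1..k. (fps_X ^ 3) ^ i + 1 :: rat fps)" by (simp add: qplus_def add.commute)
  also have "\<dots> = (\<Sum>D\<in>Pow {1..k}. \<Prod>i\<in>D. (fps_X ^ 3) ^ i)" by (simp add: prod_add)
  also have "\<dots> = (\<Sum>D\<in>Pow {1..k}. fps_X ^ (3 * \<Sum>D))" by (simp add: power_sum power_mult)
  finally show ?thesis by (simp add: gf_finite)
qed

text \<open>
A part \<open>j \<le> k\<close> occurs \<open>2(c+1)\<close> times, a larger one \<open>c + 1\<close> times, with \<open>c\<close> arbitrary. So the part \<open>j\<close>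
contributes \<open>X^d / (1 - X^d)\<close>, where \<open>d\<close> is \<open>2j\<close> or \<open>j\<close>, and for \<open>j \<le> k\<close> the denominator is
\<open>(1 + X^j) (1 - X^j)\<close>.
\<close>
lemma gf_positive_msets:
  "gf (positive_msets k) sum_mset * (qplus fps_X k * qpoch fps_X (2 * k + 1))
    = fps_X ^ (triangle (2 * k + 1) + triangle k)"
proof -
  \<comment> \<open>The multiplicity of the part \<open>j\<close> changes in steps of weight \<open>d j\<close>.\<close>
  define d where "d = (\<lambda>j::nat. if j \<le> k then 2 * j else j)"
  define C where "C = (\<lambda>j. if j \<le> k then {c::nat. even c \<and> c \<ge> 2} else {c. c \<ge> 1})"
  define S where "S = (\<lambda>j. (\<lambda>c. replicate_mset c j) ` C j)"
  have "positive_msets k = mset_family {1..2 * k + 1} (\<lambda>j. {j}) S"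
  proof -
    have mem: "filter_mset (\<lambda>x. x \<in> {j}) M \<in> S j \<longleftrightarrow> count M j \<in> C j" for M j
      by (auto simp: S_def filter_eq_replicate_mset image_iff) (metis count_replicate_mset)
    have iv: "{1..2 * k + 1} = {1..k} \<union> {k + 1..2 * k + 1}" by auto
    have "(\<forall>j\<in>{1..2 * k + 1}. count M j \<in> C j) \<longleftrightarrow>
      (\<forall>i\<in>{1..k}. even (count M i) \<and> count M i \<ge> 2) \<and> (\<forall>i\<in>{k + 1..2 * k + 1}. count M i \<ge> 1)" for M
      unfolding iv ball_Un by (intro arg_cong2[where f = "(\<and>)"] ball_cong refl) (simp_all add: C_def)
    then show ?thesis unfolding positive_msets_def mset_family_def mem by simp
  qed
  also have "gf \<dots> sum_mset = (\<Prod>j=1..2 * k + 1. gf (S j) sum_mset)"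
    by (rule gf_mset_family) (auto simp: disjoint_family_on_def S_def split: if_splits)
  finally have "gf (positive_msets k) sum_mset * (\<Prod>j=1..2 * k + 1. 1 - fps_X ^ d j)
      = (\<Prod>j=1..2 * k + 1. gf (S j) sum_mset * (1 - fps_X ^ d j))"
    by (simp only: prod.distrib)
  also have "\<dots> = (\<Prod>j=1..2 * k + 1. fps_X ^ d j)"
  proof (intro prod.cong refl)
    fix j assume j: "j \<in> {1..2 * k + 1}"
    have "gf (S j) sum_mset = gf (C j) (\<lambda>c. j * c)"
      unfolding S_def using j by (intro gf_replicate_mset) simp
    also have "\<dots> = gf UNIV (\<lambda>c. d j + d j * c)"
    proof (rule gf_bij[symmetric])
      show "bij_betw (\<lambda>c. if j \<le> k then 2 * (c + 1) else c + 1) UNIV (C j)"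
        by (rule bij_betw_byWitness[where f' = "\<lambda>c. if j \<le> k then c div 2 - 1 else c - 1"]) (auto simp: C_def)
    qed (auto simp: d_def algebra_simps)
    also have "\<dots> = fps_X ^ d j * gf UNIV (\<lambda>c. d j * c)" by (rule gf_shift)
    also have "\<dots> * (1 - fps_X ^ d j) = fps_X ^ d j * (gf UNIV (\<lambda>c. d j * c) * (1 - fps_X ^ d j))"
      by (simp only: mult.assoc)
    also have "\<dots> = fps_X ^ d j" using j by (subst gf_multiples) (auto simp: d_def)
    finally show "gf (S j) sum_mset * (1 - fps_X ^ d j) = fps_X ^ d j" .
  qed
  also have "\<dots> = fps_X ^ (\<Sum>j=1..2 * k + 1. d j)" by (rule power_sum[symmetric])
  also have "(\<Sum>j=1..2 * k + 1. d j) = triangle (2 * k + 1) + triangle k"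
  proof -
    have "(\<Sum>j=1..m. d j) = triangle m + triangle (min m k)" for m
    proof (induction m)
      case (Suc m)
      have "min m k = k \<and> min (Suc m) k = k" if "\<not> Suc m \<le> k" using that by auto
      then show ?case using Suc by (cases "Suc m \<le> k") (auto simp: d_def)
    qed simp
    moreover have "min (2 * k + 1) k = k" by simp
    ultimately show ?thesis by metis
  qed
  also have "(\<Prod>j=1..2 * k + 1. 1 - fps_X ^ d j :: rat fps) = qplus fps_X k * qpoch fps_X (2 * k + 1)"
  proof -
    have "(\<Prod>j=1..m. 1 - fps_X ^ d j :: rat fps) = qplus fps_X (min m k) * qpoch fps_X m" for m
    proof (induction m)
      case (Suc m)
      have e: "1 - fps_X ^ (2 * Suc m) = (1 + fps_X ^ Suc m) * (1 - fps_X ^ Suc m :: rat fps)"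
        by (simp add: algebra_simps power_add[symmetric] mult_2 del: power_Suc)
      show ?case
      proof (cases "Suc m \<le> k")
        case True
        then have "d (Suc m) = 2 * Suc m" "min m k = m" "min (Suc m) k = Suc m" by (auto simp: d_def)
        then show ?thesis using Suc e by (simp add: qplus_def qpoch_Suc mult_ac del: power_Suc mult_Suc_right)
      next
        case False
        then have "d (Suc m) = Suc m" "min m k = k" "min (Suc m) k = k" by (auto simp: d_def)
        then show ?thesis using Suc by (simp add: qpoch_Suc mult_ac)
      qed
    qed (simp add: qplus_def)
    moreover have "min (2 * k + 1) k = k" by simp
    ultimately show ?thesis by metis
  qed
  finally show ?thesis .
qed

text \<open>
Numbering the pairs of consecutive parts that are not divisible by 3 by \<open>b\<close>, the exclusion
concerns \<open>9j+1, 9j+2\<close> for \<open>b = 3j\<close> and \<open>9j+7, 9j+8\<close> for \<open>b = 3j + 2\<close>, but not \<open>9j+4, 9j+5\<close>.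
\<close>
definition right_block :: "nat \<Rightarrow> nat multiset set" where
  "right_block b = {M. set_mset M \<subseteq> {3 * b + 1, 3 * b + 2} \<and>
     (b mod 3 \<noteq> 1 \<longrightarrow> \<not> (3 * b + 1 \<in># M \<and> 3 * b + 2 \<in># M))}"

text \<open>
All parts are below \<open>9n\<close>, which is no restriction on partitions of \<open>n\<close>.
\<close>
definition right_msets :: "nat \<Rightarrow> nat multiset set" where
  "right_msets n = mset_family {..<3 * n} (\<lambda>b. {3 * b + 1, 3 * b + 2}) right_block"

lemma gf_right_msets:
  "gf (right_msets n) sum_mset * (\<Prod>b<3 * n. (1 - fps_X ^ (3 * b + 1)) * (1 - fps_X ^ (3 * b + 2)))
    = qodd_not3 (fps_X ^ 3) (3 * n)"
proof -
  have "gf (right_msets n) sum_mset = (\<Prod>b<3 * n. gf (right_block b) sum_mset)"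
    unfolding right_msets_def
  proof (rule gf_mset_family)
    show "disjoint_family_on (\<lambda>b. {3 * b + 1, 3 * b + 2}) {..<3 * n}"
      unfolding disjoint_family_on_def by auto
  qed (auto simp: right_block_def)
  also have "\<dots> * (\<Prod>b<3 * n. (1 - fps_X ^ (3 * b + 1)) * (1 - fps_X ^ (3 * b + 2)))
      = (\<Prod>b<3 * n. gf (right_block b) sum_mset * ((1 - fps_X ^ (3 * b + 1)) * (1 - fps_X ^ (3 * b + 2))))"
    by (simp only: prod.distrib)
  also have "\<dots> = qodd_not3 (fps_X ^ 3) (3 * n)"
    unfolding qodd_not3_def
  proof (intro prod.cong refl)
    fix b
    have e: "(fps_X ^ 3) ^ (2 * b + 1) = (fps_X :: rat fps) ^ (3 * b + 1 + (3 * b + 2))"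
      unfolding power_mult[symmetric] by (rule arg_cong[of _ _ "\<lambda>n. fps_X ^ n"]) simp
    show "gf (right_block b) sum_mset * ((1 - fps_X ^ (3 * b + 1)) * (1 - fps_X ^ (3 * b + 2)))
      = (if b mod 3 = 1 then 1 else 1 - (fps_X ^ 3) ^ (2 * b + 1))"
    proof (cases "b mod 3 = 1")
      case True
      then have "right_block b = {M. set_mset M \<subseteq> {3 * b + 1, 3 * b + 2}}" by (simp add: right_block_def)
      then show ?thesis using True gf_pair[of "3 * b + 1" "3 * b + 2"] by simp
    next
      case False
      then have "right_block b = {M. set_mset M \<subseteq> {3 * b + 1, 3 * b + 2} \<and>
          \<not> (3 * b + 1 \<in># M \<and> 3 * b + 2 \<in># M)}" by (simp add: right_block_def)
      then show ?thesis unfolding e using False gf_pair_not_both[of "3 * b + 1" "3 * b + 2"] by simp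
    qed
  qed
  finally show ?thesis .
qed

section \<open>Comparison of coefficients\<close>

lemma qpoch_fps_X_unit: "d > 0 \<Longrightarrow> qpoch (fps_X ^ d :: rat fps) n dvd 1"
proof -
  assume "d > 0"
  then have "fps_nth (qpoch (fps_X ^ d :: rat fps) n) 0 = 1"
    by (induction n) (simp_all add: qpoch_Suc power_mult[symmetric] fps_X_power_nth del: power_Suc)
  then show ?thesis by simp
qed

lemma qpoch_fps_X_inverse: "\<exists>u. qpoch fps_X n * u = (1 :: rat fps)"
proof -
  have "qpoch (fps_X :: rat fps) n dvd 1"
    using qpoch_fps_X_unit[of 1 n] by (simp only: power_one_right zero_less_one)
  then show ?thesis by (metis dvdE)
qed

lemma eq_mod_fps_nth:
  assumes "eq_mod (fps_X ^ Suc n) f g"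
  shows "fps_nth f n = fps_nth g n"
proof -
  from assms obtain h where "f - g = fps_X ^ Suc n * h" unfolding eq_mod_def by (rule dvdE)
  then have "fps_nth (f - g) n = 0" by (simp add: fps_X_power_mult_nth del: power_Suc)
  then show ?thesis by simp
qed

definition signed_msets :: "nat \<Rightarrow> nat \<Rightarrow> (nat multiset \<times> nat multiset) set" where
  "signed_msets n k = {(M, N). M \<in> positive_msets k \<and> N \<in> negative_msets k \<and> sum_mset M = n + 1 + sum_mset N}"

text \<open>
Replacing the negative parts by the set \<open>D\<close> of \<open>negative_of\<close> moves their sum to the other side of the
equation \<open>n + 1 = sum of M - sum of N\<close>, so that the pairs \<open>(M, D)\<close> have the fixed total weight \<open>m\<close> below. The
factor \<open>\<Prod>i=1..k. (1 + X^(3i))\<close> contributed by \<open>D\<close> cancels the \<open>\<Prod>i=1..k. (1 + X^i)\<close> in the denominator for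
\<open>M\<close> up to the polynomial \<open>qquad 1\<close>, and the constant shift reduces the power of \<open>X\<close> to \<open>X^(k(k+1))\<close>.
\<close>
lemma signed_msets:
  assumes u: "qpoch fps_X (2 * k + 1) * u = (1 :: rat fps)"
  shows "finite (signed_msets n k)"
    and "of_nat (card (signed_msets n k)) = fps_nth (fps_X ^ (k * (k + 1)) * qquad 1 fps_X k * u) n"
proof -
  \<comment> \<open>The weight of \<open>(M, D)\<close> and its value on \<open>signed_msets n k\<close>, by \<open>sum_negative_of\<close>.\<close>
  let ?w = "\<lambda>(M, D). sum_mset M + 3 * \<Sum>D"
  define m where "m = n + (1 + k + 3 * triangle k)"
  let ?P = "{z \<in> positive_msets k \<times> Pow {1..k}. ?w z = m}"
  have bij: "bij_betw (\<lambda>(M, D). (M, negative_of k D)) ?P (signed_msets n k)"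
  proof -
    have "inj_on (\<lambda>(M, D). (M, negative_of k D)) ?P"
      using bij_negative_of[of k] unfolding bij_betw_def by (auto simp: inj_on_def)
    moreover have "(\<lambda>(M, D). (M, negative_of k D)) ` ?P = signed_msets n k"
    proof (intro equalityI subsetI)
      fix z assume "z \<in> (\<lambda>(M, D). (M, negative_of k D)) ` ?P"
      then obtain M D where z: "z = (M, negative_of k D)" "M \<in> positive_msets k" "D \<subseteq> {1..k}"
        "sum_mset M + 3 * \<Sum>D = m" by auto
      have "negative_of k D \<in> negative_msets k"
        using bij_betwE[OF bij_negative_of] z(3) by blast
      then show "z \<in> signed_msets n k"
        using z sum_negative_of[OF z(3)] by (simp add: signed_msets_def m_def)
    next
      fix z assume "z \<in> signed_msets n k"
      then obtain M N where z: "z = (M, N)" "M \<in> positive_msets k" "N \<in> negative_msets k"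
        "sum_mset M = n + 1 + sum_mset N" by (auto simp: signed_msets_def)
      from z(3) obtain D where D: "D \<subseteq> {1..k}" "N = negative_of k D"
        using bij_negative_of[of k] unfolding bij_betw_def by auto
      show "z \<in> (\<lambda>(M, D). (M, negative_of k D)) ` ?P"
        using z D sum_negative_of[OF D(1)] by (intro image_eqI[of _ _ "(M, D)"]) (simp_all add: m_def)
    qed
    ultimately show ?thesis by (simp add: bij_betw_def)
  qed
  have fin: "finite_fibres (positive_msets k) sum_mset"
    by (rule finite_fibres_subset[OF finite_fibres_sum_mset]) (auto simp: positive_msets_def)
  have "finite ?P"
  proof (rule finite_subset)
    show "?P \<subseteq> (\<Union>i\<le>m. {M \<in> positive_msets k. sum_mset M = i}) \<times> Pow {1..k}" by auto
  qed (use fin in \<open>auto simp: finite_fibres_def\<close>)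
  then show "finite (signed_msets n k)" using bij_betw_finite[OF bij] by simp
  let ?g = "gf (positive_msets k) sum_mset"
  \<comment> \<open>The exponent of \<open>gf_positive_msets\<close> is the shift in \<open>m\<close> plus \<open>k(k+1)\<close>.\<close>
  have e: "triangle (2 * k + 1) + triangle k = 1 + k + 3 * triangle k + k * (k + 1)"
    using triangle_double[of k] triangle_double[of "2 * k + 1"] by (simp add: algebra_simps)
  have "gf (positive_msets k \<times> Pow {1..k}) ?w = ?g * qplus (fps_X ^ 3) k"
    unfolding gf_subset_sums[symmetric] by (intro gf_Times fin finite_fibres_finite) simp
  also have "\<dots> = ?g * (qplus fps_X k * (qpoch fps_X (2 * k + 1) * u)) * qquad 1 fps_X k"
    unfolding u qquad_1_mult_qplus[symmetric] by (simp add: mult_ac)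
  also have "\<dots> = (?g * (qplus fps_X k * qpoch fps_X (2 * k + 1))) * (u * qquad 1 fps_X k)"
    by (simp only: mult_ac)
  also have "\<dots> = fps_X ^ (1 + k + 3 * triangle k) * (fps_X ^ (k * (k + 1)) * qquad 1 fps_X k * u)"
    unfolding gf_positive_msets e power_add by (simp only: mult_ac)
  finally have "fps_nth (gf (positive_msets k \<times> Pow {1..k}) ?w) m
      = fps_nth (fps_X ^ (k * (k + 1)) * qquad 1 fps_X k * u) n"
    by (simp only: fps_X_power_mult_nth m_def) simp
  then show "of_nat (card (signed_msets n k)) = fps_nth (fps_X ^ (k * (k + 1)) * qquad 1 fps_X k * u) n"
    using bij_betw_same_card[OF bij] by (simp add: gf_nth)
qed

text \<open>
The smallest exponent \<open>k(k+1)\<close> of the generating function exceeds \<open>n\<close>.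
\<close>
lemma signed_msets_empty:
  assumes "k > n"
  shows "signed_msets n k = {}"
proof -
  obtain u where u: "qpoch fps_X (2 * k + 1) * u = (1 :: rat fps)"
    using qpoch_fps_X_inverse by blast
  have "n < k * (k + 1)" using assms by (simp add: less_le_trans)
  then have "fps_nth (fps_X ^ (k * (k + 1)) * qquad 1 fps_X k * u) n = 0"
    by (simp only: mult.assoc fps_X_power_mult_nth if_True)
  then show ?thesis using signed_msets[OF u, of n] by simp
qed

lemma card_signed_msets_eq:
  "(\<Sum>k\<le>n. card (signed_msets n k)) = card {M \<in> right_msets n. sum_mset M = n}"
proof -
  obtain u where u: "\<And>m. qpoch fps_X m * u m = (1 :: rat fps)"
    using qpoch_fps_X_inverse by metis
  have "of_nat (\<Sum>k\<le>n. card (signed_msets n k))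
      = fps_nth (\<Sum>k\<le>n. fps_X ^ (k * (k + 1)) * qquad 1 fps_X k * u (2 * k + 1)) n"
    by (simp add: signed_msets(2)[OF u] fps_sum_nth)
  also have "\<dots> = fps_nth (gf (right_msets n) sum_mset) n"
  proof (intro eq_mod_fps_nth slater_identity_mod u gf_right_msets)
    show "qpoch (fps_X :: rat fps) m dvd 1" "qpoch (fps_X ^ 3 :: rat fps) m dvd 1" "qpoch ((fps_X ^ 3) ^ 3 :: rat fps) m dvd 1" for m
      using qpoch_fps_X_unit[of 1 m] qpoch_fps_X_unit[of 3 m] qpoch_fps_X_unit[of 9 m]
      by (simp_all add: power_mult[symmetric])
  qed
  also have "\<dots> = of_nat (card {M \<in> right_msets n. sum_mset M = n})" by (rule gf_nth)
  finally show ?thesis by (simp only: of_nat_eq_iff)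
qed

text \<open>
The conditions of the theorem with the largest part named \<open>2k + 1\<close>, which turns its halves into
\<open>k\<close> and \<open>3k + 1\<close>.
\<close>
definition signed_condition :: "nat \<Rightarrow> nat list \<Rightarrow> nat list \<Rightarrow> bool" where
  "signed_condition k p v \<longleftrightarrow> p \<noteq> [] \<and> largest_part p = 2 * k + 1 \<and>
     (\<forall>i\<in>{1..k}. even (count_list p i) \<and> count_list p i \<ge> 2) \<and>
     (\<forall>i\<in>{k + 1..2 * k + 1}. count_list p i \<ge> 1) \<and>
     length v = k \<and> (\<forall>x\<in>set v. x mod 3 = 1 \<and> x \<le> 3 * k + 1 \<and> (x > 1 \<longrightarrow> count_list v x \<le> 1))"

text \<open>
Since \<open>2k + 1\<close> is required to occur, the bound \<open>2k + 1\<close> on all parts says that it is the largest one.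
\<close>
lemma positive_msets_iff:
  assumes "is_partition p"
  shows "mset p \<in> positive_msets k \<longleftrightarrow> p \<noteq> [] \<and> largest_part p = 2 * k + 1 \<and>
     (\<forall>i\<in>{1..k}. even (count_list p i) \<and> count_list p i \<ge> 2) \<and>
     (\<forall>i\<in>{k + 1..2 * k + 1}. count_list p i \<ge> 1)" (is "_ \<longleftrightarrow> _ \<and> _ \<and> ?c \<and> ?d")
proof -
  have "set p \<subseteq> {1..2 * k + 1} \<longleftrightarrow> p \<noteq> [] \<and> largest_part p = 2 * k + 1" if ?d
  proof -
    from that have "count_list p (2 * k + 1) \<ge> 1" by simp
    then have top: "2 * k + 1 \<in> set p" by (metis count_list_0_iff not_one_le_zero)
    then have ne: "p \<noteq> []" by auto
    have le: "\<forall>x\<in>set p. x \<le> hd p" and pos: "\<forall>x\<in>set p. 1 \<le> x"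
      using assms by (cases p; auto simp: is_partition_def Suc_le_eq)+
    show ?thesis
    proof
      assume "set p \<subseteq> {1..2 * k + 1}"
      then have "hd p \<le> 2 * k + 1" using hd_in_set[OF ne] by (meson atLeastAtMost_iff subsetD)
      then show "p \<noteq> [] \<and> largest_part p = 2 * k + 1" using ne bspec[OF le top] by simp
    next
      assume "p \<noteq> [] \<and> largest_part p = 2 * k + 1"
      then show "set p \<subseteq> {1..2 * k + 1}" using le pos by (metis atLeastAtMost_iff subsetI)
    qed
  qed
  moreover have "mset p \<in> positive_msets k \<longleftrightarrow> set p \<subseteq> {1..2 * k + 1} \<and> ?c \<and> ?d"
    by (simp only: positive_msets_def mem_Collect_eq set_mset_mset count_mset)
  ultimately show ?thesis by argo
qed

lemma signed_partitions_bij: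
  "bij_betw (\<lambda>(p, v). (mset p, mset v))
    {(p, v). signed_partition_of (int n + 1) (p, v) \<and> signed_condition k p v} (signed_msets n k)"
proof -
  let ?L = "{p. is_partition p \<and> mset p \<in> positive_msets k}"
  let ?R = "{p. is_partition p \<and> mset p \<in> negative_msets k}"
  let ?f = "\<lambda>(p, v). (mset p, mset v)"
  have 1: "bij_betw mset ?L (positive_msets k)"
  proof -
    have "{M. 0 \<notin># M \<and> M \<in> positive_msets k} = positive_msets k" by (auto simp: positive_msets_def)
    then show ?thesis using is_partition_bij_mset[of "\<lambda>M. M \<in> positive_msets k"] by simp
  qed
  have 2: "bij_betw mset ?R (negative_msets k)"
  proof -
    have "{M. 0 \<notin># M \<and> M \<in> negative_msets k} = negative_msets k" by (auto simp: negative_msets_def)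
    then show ?thesis using is_partition_bij_mset[of "\<lambda>M. M \<in> negative_msets k"] by simp
  qed
  have neg: "mset v \<in> negative_msets k \<longleftrightarrow> length v = k \<and>
      (\<forall>x\<in>set v. x mod 3 = 1 \<and> x \<le> 3 * k + 1 \<and> (x > 1 \<longrightarrow> count_list v x \<le> 1))" for v
    by (simp add: negative_msets_def count_mset)
  have S: "{(p, v). signed_partition_of (int n + 1) (p, v) \<and> signed_condition k p v}
      = {(p, v) \<in> ?L \<times> ?R. sum_list p = n + 1 + sum_list v}"
    by (auto simp: signed_partition_of_def signed_condition_def positive_msets_iff neg)
  have "inj_on ?f {(p, v) \<in> ?L \<times> ?R. sum_list p = n + 1 + sum_list v}"
    using bij_betw_imp_inj_on[OF 1] bij_betw_imp_inj_on[OF 2] by (auto simp: inj_on_def)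
  moreover have "?f ` {(p, v) \<in> ?L \<times> ?R. sum_list p = n + 1 + sum_list v} = signed_msets n k"
  proof (intro equalityI subsetI)
    fix z assume "z \<in> signed_msets n k"
    then obtain M N where z: "z = (M, N)" "M \<in> positive_msets k" "N \<in> negative_msets k"
        "sum_mset M = n + 1 + sum_mset N" by (auto simp: signed_msets_def)
    obtain p v where "p \<in> ?L" "v \<in> ?R" "M = mset p" "N = mset v"
      using z bij_betw_imp_surj_on[OF 1] bij_betw_imp_surj_on[OF 2] by blast
    then show "z \<in> ?f ` {(p, v) \<in> ?L \<times> ?R. sum_list p = n + 1 + sum_list v}"
      using z by (intro image_eqI[of _ _ "(p, v)"]) (auto simp: sum_mset_sum_list)
  qed (auto simp: signed_msets_def sum_mset_sum_list)
  ultimately show ?thesis unfolding S by (simp add: bij_betw_def)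
qed

lemma right_msets_iff:
  assumes "is_partition p" "sum_list p = n"
  shows "mset p \<in> right_msets n \<longleftrightarrow> (\<forall>x \<in> set p. x mod 9 \<in> {1, 2, 4, 5, 7, 8}) \<and>
            (\<forall>j. \<not> (9 * j + 1 \<in> set p \<and> 9 * j + 2 \<in> set p)) \<and>
            (\<forall>k. \<not> (9 * k + 7 \<in> set p \<and> 9 * k + 8 \<in> set p))"
proof -
  have bound: "0 < x \<and> x \<le> n" if "x \<in> set p" for x
    using assms that member_le_sum_list[OF that] by (auto simp: is_partition_def)
  have "mset p \<in> right_msets n \<longleftrightarrow> (\<forall>x\<in>set p. \<exists>b<3 * n. x = 3 * b + 1 \<or> x = 3 * b + 2) \<and>
      (\<forall>b<3 * n. b mod 3 \<noteq> 1 \<longrightarrow> \<not> (3 * b + 1 \<in> set p \<and> 3 * b + 2 \<in> set p))"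
    by (auto simp: right_msets_def mset_family_def right_block_def)
  also have "(\<forall>x\<in>set p. \<exists>b<3 * n. x = 3 * b + 1 \<or> x = 3 * b + 2) \<longleftrightarrow>
      (\<forall>x\<in>set p. x mod 9 \<in> {1, 2, 4, 5, 7, 8})"
  proof (intro ball_cong refl)
    fix x assume "x \<in> set p"
    then have x: "0 < x" "x \<le> n" using bound by auto
    have "(\<exists>b<3 * n. x = 3 * b + 1 \<or> x = 3 * b + 2) \<longleftrightarrow> x mod 3 \<noteq> 0"
    proof
      assume "x mod 3 \<noteq> 0"
      then have "x = 3 * (x div 3) + 1 \<or> x = 3 * (x div 3) + 2" by presburger
      moreover have "x div 3 < 3 * n" using x by simp
      ultimately show "\<exists>b<3 * n. x = 3 * b + 1 \<or> x = 3 * b + 2" by blast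
    qed (auto, presburger+)
    also have "\<dots> \<longleftrightarrow> x mod 9 \<in> {1, 2, 4, 5, 7, 8}"
      unfolding insert_iff empty_iff by presburger
    finally show "(\<exists>b<3 * n. x = 3 * b + 1 \<or> x = 3 * b + 2) \<longleftrightarrow> x mod 9 \<in> {1, 2, 4, 5, 7, 8}" .
  qed
  also have "(\<forall>b<3 * n. b mod 3 \<noteq> 1 \<longrightarrow> \<not> (3 * b + 1 \<in> set p \<and> 3 * b + 2 \<in> set p)) \<longleftrightarrow>
      (\<forall>b. b mod 3 \<noteq> 1 \<longrightarrow> \<not> (3 * b + 1 \<in> set p \<and> 3 * b + 2 \<in> set p))"
    using bound by force
  also have "\<dots> \<longleftrightarrow> (\<forall>j. \<not> (9 * j + 1 \<in> set p \<and> 9 * j + 2 \<in> set p)) \<and>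
            (\<forall>k. \<not> (9 * k + 7 \<in> set p \<and> 9 * k + 8 \<in> set p))"
  proof (intro iffI conjI allI impI)
    fix j :: nat assume a: "\<forall>b. b mod 3 \<noteq> 1 \<longrightarrow> \<not> (3 * b + 1 \<in> set p \<and> 3 * b + 2 \<in> set p)"
    have "3 * j mod 3 \<noteq> 1" "(3 * j + 2) mod 3 \<noteq> 1" by presburger+
    with a have "\<not> (3 * (3 * j) + 1 \<in> set p \<and> 3 * (3 * j) + 2 \<in> set p)"
      "\<not> (3 * (3 * j + 2) + 1 \<in> set p \<and> 3 * (3 * j + 2) + 2 \<in> set p)" by blast+
    then show "\<not> (9 * j + 1 \<in> set p \<and> 9 * j + 2 \<in> set p)" "\<not> (9 * j + 7 \<in> set p \<and> 9 * j + 8 \<in> set p)"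
      by (simp_all add: algebra_simps)
  next
    fix b :: nat
    assume a: "(\<forall>j. \<not> (9 * j + 1 \<in> set p \<and> 9 * j + 2 \<in> set p)) \<and>
            (\<forall>k. \<not> (9 * k + 7 \<in> set p \<and> 9 * k + 8 \<in> set p))" and b: "b mod 3 \<noteq> 1"
    define j where "j = b div 3"
    from b have "b = 3 * j \<or> b = 3 * j + 2" unfolding j_def by presburger
    then have "3 * b + 1 = 9 * j + 1 \<and> 3 * b + 2 = 9 * j + 2 \<or> 3 * b + 1 = 9 * j + 7 \<and> 3 * b + 2 = 9 * j + 8" by auto
    with a show "\<not> (3 * b + 1 \<in> set p \<and> 3 * b + 2 \<in> set p)" by metis
  qed
  finally show ?thesis .
qed

theorem theorem5p17:
  fixes n :: nat
  shows "card {(\<pi>, \<nu>). signed_partition_of (int n + 1) (\<pi>, \<nu>) \<and> \<pi> \<noteq> [] \<and>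
            odd (largest_part \<pi>) \<and>
            (\<forall>i \<in> {1..(largest_part \<pi> - 1) div 2}.
               even (count_list \<pi> i) \<and> count_list \<pi> i \<ge> 2) \<and>
            (\<forall>i \<in> {(largest_part \<pi> - 1) div 2 + 1..largest_part \<pi>}. count_list \<pi> i \<ge> 1) \<and>
            length \<nu> = (largest_part \<pi> - 1) div 2 \<and>
            (\<forall>x \<in> set \<nu>. x mod 3 = 1 \<and> x \<le> (3 * largest_part \<pi> - 1) div 2 \<and>
               (x > 1 \<longrightarrow> count_list \<nu> x \<le> 1))}
       = card {p. partition_of n p \<and>
            (\<forall>x \<in> set p. x mod 9 \<in> {1, 2, 4, 5, 7, 8}) \<and>
            (\<forall>j. \<not> (9 * j + 1 \<in> set p \<and> 9 * j + 2 \<in> set p)) \<and>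
            (\<forall>k. \<not> (9 * k + 7 \<in> set p \<and> 9 * k + 8 \<in> set p))}"
    (is "card ?L = card ?R")
proof -
  define A where "A = (\<lambda>k. {(p, v). signed_partition_of (int n + 1) (p, v) \<and> signed_condition k p v})"
  have cond: "signed_condition k \<pi> \<nu> \<longleftrightarrow> \<pi> \<noteq> [] \<and> largest_part \<pi> = 2 * k + 1 \<and>
            (\<forall>i \<in> {1..(largest_part \<pi> - 1) div 2}.
               even (count_list \<pi> i) \<and> count_list \<pi> i \<ge> 2) \<and>
            (\<forall>i \<in> {(largest_part \<pi> - 1) div 2 + 1..largest_part \<pi>}. count_list \<pi> i \<ge> 1) \<and>
            length \<nu> = (largest_part \<pi> - 1) div 2 \<and>
            (\<forall>x \<in> set \<nu>. x mod 3 = 1 \<and> x \<le> (3 * largest_part \<pi> - 1) div 2 \<and>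
               (x > 1 \<longrightarrow> count_list \<nu> x \<le> 1))" for k \<pi> \<nu>
  proof (cases "largest_part \<pi> = 2 * k + 1")
    case True
    have "(largest_part \<pi> - 1) div 2 = k" "(3 * largest_part \<pi> - 1) div 2 = 3 * k + 1"
      unfolding True by simp_all
    then show ?thesis unfolding signed_condition_def by (simp only: True)
  qed (simp add: signed_condition_def)
  have "?L = (\<Union>k. A k)"
  proof (intro equalityI subsetI)
    fix z assume "z \<in> ?L"
    moreover obtain p v where "z = (p, v)" by (cases z)
    moreover from calculation obtain k where "largest_part p = 2 * k + 1" by (auto elim: oddE)
    ultimately show "z \<in> (\<Union>k. A k)" unfolding A_def by (auto simp only: cond)
  next
    fix z assume "z \<in> (\<Union>k. A k)"
    then obtain k p v where z: "z = (p, v)" "signed_partition_of (int n + 1) (p, v)" "signed_condition k p v"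
      unfolding A_def by auto
    moreover from z(3) have "odd (largest_part p)" by (simp add: signed_condition_def)
    ultimately show "z \<in> ?L" unfolding cond by blast
  qed
  also have "\<dots> = (\<Union>k\<le>n. A k)"
  proof -
    have "A k = {}" if "k > n" for k
      using signed_partitions_bij[of n k] unfolding signed_msets_empty[OF that] A_def bij_betw_def
      by (simp only: image_is_empty)
    then show ?thesis by (auto simp: not_le[symmetric])
  qed
  also have "card \<dots> = (\<Sum>k\<le>n. card (A k))"
  proof (rule card_UN_disjoint)
    show "\<forall>k\<in>{..n}. finite (A k)"
    proof
      fix k
      obtain u where "qpoch fps_X (2 * k + 1) * u = (1 :: rat fps)"
        using qpoch_fps_X_inverse by blast
      then show "finite (A k)"
        using signed_msets(1) bij_betw_finite[OF signed_partitions_bij] unfolding A_def by blast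
    qed
    show "\<forall>i\<in>{..n}. \<forall>j\<in>{..n}. i \<noteq> j \<longrightarrow> A i \<inter> A j = {}"
      by (auto simp: A_def signed_condition_def)
  qed simp
  also have "\<dots> = (\<Sum>k\<le>n. card (signed_msets n k))"
    using bij_betw_same_card[OF signed_partitions_bij] by (simp add: A_def)
  also have "\<dots> = card {M \<in> right_msets n. sum_mset M = n}" by (rule card_signed_msets_eq)
  also have "\<dots> = card {p. is_partition p \<and> (mset p \<in> right_msets n \<and> sum_mset (mset p) = n)}"
  proof -
    have "{M. 0 \<notin># M \<and> (M \<in> right_msets n \<and> sum_mset M = n)} = {M \<in> right_msets n. sum_mset M = n}"
      by (auto simp: right_msets_def mset_family_def)
    then show ?thesis
      using bij_betw_same_card[OF is_partition_bij_mset[of "\<lambda>M. M \<in> right_msets n \<and> sum_mset M = n"]] by simp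
  qed
  also have "{p. is_partition p \<and> (mset p \<in> right_msets n \<and> sum_mset (mset p) = n)} = ?R"
  proof (rule Collect_cong)
    fix p
    show "(is_partition p \<and> (mset p \<in> right_msets n \<and> sum_mset (mset p) = n)) \<longleftrightarrow> partition_of n p \<and>
            (\<forall>x \<in> set p. x mod 9 \<in> {1, 2, 4, 5, 7, 8}) \<and>
            (\<forall>j. \<not> (9 * j + 1 \<in> set p \<and> 9 * j + 2 \<in> set p)) \<and>
            (\<forall>k. \<not> (9 * k + 7 \<in> set p \<and> 9 * k + 8 \<in> set p))"
      unfolding partition_of_def sum_mset_sum_list using right_msets_iff[of p n] by argo
  qed
  finally show ?thesis .
qed

end
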